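(* Let $S,T\subset C_d$ be nonempty aperiodic masks. If $Z(S)=Z(T)$, then, for every $m\ge1$, there is a unique isomorphism $$\varphi:Y_{S,m}\xrightarrow{\ \sim\ }Y_{T,m},\qquad \varphi\circ\nu_S=\nu_T .$$ If $m\ge b(d)$, the converse holds: the existence of an isomorphism $\varphi:Y_{S,m}\to Y_{T,m}$ with $\varphi\circ\nu_S=\nu_T$ implies $Z(S)=Z(T)$.
   Context: $K$ is an algebraically closed field of characteristic zero, $d\ge2$, $\zeta\in K$ is a fixed primitive $d$th root of unity, $C_d=\mathbb Z/d\mathbb Z$. A subset (mask) $S\subset C_d$ is aperiodic if no nonidentity translation of $C_d$ fixes it. Put $\lambda_j(S)=\sum_{a\in S}\zeta^{aj}$ and $Z(S)=\{j\in C_d:\lambda_j(S)=0\}$. Let $b(d)=d/p_{\min}(d)$, where $p_{\min}(d)$ is the smallest prime factor of $d$. Identify $\operatorname{Sym}^m\mathbb P^1=\mathbb P^m$ and define $$\nu_S:\mathbb P^m\to\mathbb P^{m|S|},\qquad \{[u_i:v_i]\}_{i=1}^m\mapsto\Big[\prod_{i=1}^m\prod_{a\in S}(v_iX-\zeta^au_iZ)\Big].$$ $Y_{S,m}$ is its reduced image, and $\nu_S:\mathbb P^m\to Y_{S,m}$ is the normalization. Isomorphisms are isomorphisms of varieties over $K$; the weights $|S|$ and $|T|$ need not be equal. *)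

theory Defs
  imports
    "HOL-Library.FuncSet"
    "HOL-Library.Poly_Mapping"
    "HOL-Computational_Algebra.Computational_Algebra"
begin

section \<open>Masks\<close>

text \<open>
  The group $C_d$ is represented by the residues \<open>{..<d}\<close> with addition modulo \<open>d\<close>;
  a mask is a subset of \<open>{..<d}\<close>.
\<close>

definition primitive_root_of_unity :: "nat \<Rightarrow> 'k::field \<Rightarrow> bool" where
  "primitive_root_of_unity d \<zeta> \<longleftrightarrow> \<zeta> ^ d = 1 \<and> (\<forall>k. 0 < k \<and> k < d \<longrightarrow> \<zeta> ^ k \<noteq> 1)"

definition translate_mask :: "nat \<Rightarrow> nat \<Rightarrow> nat set \<Rightarrow> nat set" where
  "translate_mask d t S = (\<lambda>a. (a + t) mod d) ` S"

definition aperiodic_mask :: "nat \<Rightarrow> nat set \<Rightarrow> bool" where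
  "aperiodic_mask d S \<longleftrightarrow> (\<forall>t\<in>{0<..<d}. translate_mask d t S \<noteq> S)"

definition mask_eigenvalue :: "'k::field \<Rightarrow> nat set \<Rightarrow> nat \<Rightarrow> 'k" where
  "mask_eigenvalue \<zeta> S j = (\<Sum>a\<in>S. \<zeta> ^ (a * j))"

definition mask_zeros :: "nat \<Rightarrow> 'k::field \<Rightarrow> nat set \<Rightarrow> nat set" where
  "mask_zeros d \<zeta> S = {j\<in>{..<d}. mask_eigenvalue \<zeta> S j = 0}"

definition largest_proper_divisor :: "nat \<Rightarrow> nat" where
  "largest_proper_divisor d = d div Min (prime_factors d)"

section \<open>Classical projective varieties\<close>

text \<open>
  A point of $\mathbb{P}^n$ is the set of all its homogeneous coordinate vectors
  $(x_0,\dots,x_n)$, a vector being a function on \<open>nat\<close> that vanishes beyond \<open>n\<close>.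
\<close>

definition proj_point :: "(nat \<Rightarrow> 'k::field) \<Rightarrow> (nat \<Rightarrow> 'k) set" where
  "proj_point x = {y. \<exists>c. c \<noteq> 0 \<and> y = (\<lambda>i. c * x i)}"

definition proj_space :: "nat \<Rightarrow> (nat \<Rightarrow> 'k::field) set set" where
  "proj_space n = proj_point ` {x. (\<forall>i>n. x i = 0) \<and> (\<exists>i. x i \<noteq> 0)}"

text \<open>
  Polynomials in $x_0,\dots,x_n$: finitely supported maps from exponent vectors to coefficients.
\<close>

type_synonym 'k mvpoly = "(nat \<Rightarrow>\<^sub>0 nat) \<Rightarrow>\<^sub>0 'k"

definition mvpoly_eval :: "'k::field mvpoly \<Rightarrow> (nat \<Rightarrow> 'k) \<Rightarrow> 'k" where
  "mvpoly_eval f x =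
     (\<Sum>\<alpha>\<in>Poly_Mapping.keys f. Poly_Mapping.lookup f \<alpha> *
        (\<Prod>i\<in>Poly_Mapping.keys \<alpha>. x i ^ Poly_Mapping.lookup \<alpha> i))"

definition homogeneous_poly :: "nat \<Rightarrow> nat \<Rightarrow> 'k::field mvpoly \<Rightarrow> bool" where
  "homogeneous_poly n e f \<longleftrightarrow>
     (\<forall>\<alpha>\<in>Poly_Mapping.keys f. Poly_Mapping.keys \<alpha> \<subseteq> {..n} \<and>
        (\<Sum>i\<in>Poly_Mapping.keys \<alpha>. Poly_Mapping.lookup \<alpha> i) = e)"

definition proj_zeros :: "nat \<Rightarrow> 'k::field mvpoly set \<Rightarrow> (nat \<Rightarrow> 'k) set set" where
  "proj_zeros n A = {p\<in>proj_space n. \<forall>f\<in>A. \<forall>x\<in>p. mvpoly_eval f x = 0}"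

definition zariski_closed :: "nat \<Rightarrow> (nat \<Rightarrow> 'k::field) set set \<Rightarrow> bool" where
  "zariski_closed n Z \<longleftrightarrow>
     (\<exists>A. (\<forall>f\<in>A. \<exists>e. homogeneous_poly n e f) \<and> Z = proj_zeros n A)"

definition zariski_open_in ::
  "nat \<Rightarrow> (nat \<Rightarrow> 'k::field) set set \<Rightarrow> (nat \<Rightarrow> 'k) set set \<Rightarrow> bool" where
  "zariski_open_in n Y U \<longleftrightarrow> (\<exists>Z. zariski_closed n Z \<and> U = Y - Z)"

text \<open>
  A morphism from $Y\subseteq\mathbb{P}^n$ to $Y'\subseteq\mathbb{P}^{n'}$, both with the reduced
  structure, is a map that is given Zariski-locally on $Y$ by $n'+1$ homogeneous polynomials of
  the same degree without common zero. Morphisms are extensional functions (\<open>undefined\<close>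
  outside $Y$), so that equality of morphisms is equality in HOL.
\<close>

definition variety_morphism ::
  "nat \<Rightarrow> (nat \<Rightarrow> 'k::field) set set \<Rightarrow> nat \<Rightarrow> (nat \<Rightarrow> 'k) set set \<Rightarrow>
     ((nat \<Rightarrow> 'k) set \<Rightarrow> (nat \<Rightarrow> 'k) set) \<Rightarrow> bool" where
  "variety_morphism n Y n' Y' \<phi> \<longleftrightarrow> \<phi> \<in> Y \<rightarrow>\<^sub>E Y' \<and>
     (\<forall>p\<in>Y. \<exists>U e F. zariski_open_in n Y U \<and> p \<in> U \<and>
        (\<forall>i\<le>n'. homogeneous_poly n e (F i)) \<and>
        (\<forall>q\<in>U. \<forall>x\<in>q. (\<exists>i\<le>n'. mvpoly_eval (F i) x \<noteq> 0) \<and>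
           \<phi> q = proj_point (\<lambda>i. if i \<le> n' then mvpoly_eval (F i) x else 0)))"

definition variety_isomorphism ::
  "nat \<Rightarrow> (nat \<Rightarrow> 'k::field) set set \<Rightarrow> nat \<Rightarrow> (nat \<Rightarrow> 'k) set set \<Rightarrow>
     ((nat \<Rightarrow> 'k) set \<Rightarrow> (nat \<Rightarrow> 'k) set) \<Rightarrow> bool" where
  "variety_isomorphism n Y n' Y' \<phi> \<longleftrightarrow> variety_morphism n Y n' Y' \<phi> \<and>
     (\<exists>\<psi>. variety_morphism n' Y' n Y \<psi> \<and>
        (\<forall>p\<in>Y. \<psi> (\<phi> p) = p) \<and> (\<forall>q\<in>Y'. \<phi> (\<psi> q) = q))"

section \<open>The mask maps\<close>

text \<open>
  A binary form $\sum_k f_k X^k Z^{N-k}$ of degree $N$ is represented by its dehomogenization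
  $\sum_k f_k X^k$ at $Z=1$, a polynomial of degree at most $N$ (and possibly smaller), and its
  class in $\mathbb{P}^N$ has the homogeneous coordinates $f_0,\dots,f_N$. The identification
  $\mathrm{Sym}^m\,\mathbb{P}^1=\mathbb{P}^m$ sends $\{[u_i:v_i]\}$ to the class of
  $\prod_i(v_iX-u_iZ)$. The map $\nu_S$ is described through representatives; by the lemmas
  \<open>proj_space_eq_linear_products\<close> and \<open>mask_map_linear_product\<close> below, every point of
  $\mathbb{P}^m$ has such representatives and the value does not depend on their choice.
\<close>

definition form_point :: "'k::field poly \<Rightarrow> (nat \<Rightarrow> 'k) set" where
  "form_point f = proj_point (poly.coeff f)"

definition mask_map ::
  "'k::field \<Rightarrow> nat set \<Rightarrow> nat \<Rightarrow> (nat \<Rightarrow> 'k) set \<Rightarrow> (nat \<Rightarrow> 'k) set" where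
  "mask_map \<zeta> S m p =
     (THE q. \<exists>u v. (\<forall>i<m. u i \<noteq> 0 \<or> v i \<noteq> 0) \<and>
        p = form_point (\<Prod>i<m. [:- u i, v i:]) \<and>
        q = form_point (\<Prod>i<m. \<Prod>a\<in>S. [:- (\<zeta> ^ a * u i), v i:]))"

definition mask_variety :: "'k::field \<Rightarrow> nat set \<Rightarrow> nat \<Rightarrow> (nat \<Rightarrow> 'k) set set" where
  "mask_variety \<zeta> S m = mask_map \<zeta> S m ` proj_space m"

lemma proj_point_self: "x \<in> proj_point x"
  unfolding proj_point_def by (auto intro!: exI[of _ 1])

lemma proj_point_scale:
  assumes "c \<noteq> 0"
  shows "proj_point (\<lambda>i. c * x i) = proj_point x"
proof (intro set_eqI iffI)
  fix y assume "y \<in> proj_point (\<lambda>i. c * x i)"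
  then obtain b where "b \<noteq> 0" "y = (\<lambda>i. b * (c * x i))" by (auto simp: proj_point_def)
  then show "y \<in> proj_point x"
    using assms unfolding proj_point_def by (auto intro!: exI[of _ "b * c"] simp: mult.assoc)
next
  fix y assume "y \<in> proj_point x"
  then obtain b where "b \<noteq> 0" "y = (\<lambda>i. b * x i)" by (auto simp: proj_point_def)
  then show "y \<in> proj_point (\<lambda>i. c * x i)"
    using assms unfolding proj_point_def by (auto intro!: exI[of _ "b / c"])
qed

lemma form_point_eqD:
  assumes "form_point f = form_point g"
  shows "\<exists>c. c \<noteq> 0 \<and> f = Polynomial.smult c g"
proof -
  have "poly.coeff f \<in> proj_point (poly.coeff g)"
    using assms proj_point_self unfolding form_point_def by metis
  then obtain c where "c \<noteq> 0" "poly.coeff f = (\<lambda>i. c * poly.coeff g i)"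
    by (auto simp: proj_point_def)
  then show ?thesis by (intro exI[of _ c]) (auto simp: poly_eq_iff)
qed

lemma form_point_smult:
  assumes "c \<noteq> 0"
  shows "form_point (Polynomial.smult c f) = form_point f"
proof -
  have "poly.coeff (Polynomial.smult c f) = (\<lambda>i. c * poly.coeff f i)" by auto
  then show ?thesis using assms by (simp add: form_point_def proj_point_scale)
qed

text \<open>The form $F(X,cZ)$, for a form $F(X,Z)$ of degree $m$.\<close>

definition twist_form :: "nat \<Rightarrow> 'k::field \<Rightarrow> 'k poly \<Rightarrow> 'k poly" where
  "twist_form m c f = (\<Sum>k\<le>m. Polynomial.monom (c ^ (m - k) * poly.coeff f k) k)"

lemma coeff_twist_form:
  "poly.coeff (twist_form m c f) k = (if k \<le> m then c ^ (m - k) * poly.coeff f k else 0)"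
  unfolding twist_form_def by (simp add: coeff_sum)

lemma twist_form_smult: "twist_form m c (Polynomial.smult b f) = Polynomial.smult b (twist_form m c f)"
  by (rule poly_eqI) (simp add: coeff_twist_form)

lemma twist_form_linear_mult:
  assumes "Polynomial.degree f \<le> m"
  shows "twist_form (Suc m) c ([:- u, v:] * f) = [:- (c * u), v:] * twist_form m c f"
proof (rule poly_eqI)
  fix k
  have *: "poly.coeff f k = 0" if "k > m"
    using assms that by (intro coeff_eq_0) auto
  show "poly.coeff (twist_form (Suc m) c ([:- u, v:] * f)) k =
        poly.coeff ([:- (c * u), v:] * twist_form m c f) k"
  proof (cases k)
    case 0
    then show ?thesis by (simp add: coeff_twist_form)
  next
    case (Suc l)
    consider "l < m" | "l = m" | "l > m" by linarith
    then show ?thesis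
    proof cases
      case 1
      then have "m - l = Suc (m - Suc l)" by simp
      then show ?thesis using 1 Suc by (simp add: coeff_twist_form algebra_simps)
    next
      case 2
      then show ?thesis using * Suc by (simp add: coeff_twist_form)
    next
      case 3
      then show ?thesis using Suc by (simp add: coeff_twist_form)
    qed
  qed
qed

lemma degree_linear_product: "Polynomial.degree (\<Prod>i<m. [:- u i, v i:]) \<le> (m::nat)"
proof (induction m)
  case (Suc m)
  have "Polynomial.degree [:- u m, v m:] \<le> 1" by simp
  with Suc show ?case
    using degree_mult_le[of "\<Prod>i<m. [:- u i, v i:]" "[:- u m, v m:]"]
    unfolding prod.lessThan_Suc by linarith
qed simp

lemma twist_form_linear_product:
  "twist_form m c (\<Prod>i<m. [:- u i, v i:]) = (\<Prod>i<m. [:- (c * u i), v i:])"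
proof (induction m)
  case 0
  show ?case by (rule poly_eqI) (auto simp: coeff_twist_form)
next
  case (Suc m)
  show ?case
    unfolding prod.lessThan_Suc mult.commute[of _ "[:- u m, v m:]"]
      twist_form_linear_mult[OF degree_linear_product] Suc
    by (rule mult.commute)
qed

lemma mask_map_linear_product:
  assumes "\<And>i. i < m \<Longrightarrow> u i \<noteq> 0 \<or> v i \<noteq> 0"
  shows "mask_map \<zeta> S m (form_point (\<Prod>i<m. [:- u i, v i:])) =
         form_point (\<Prod>i<m. \<Prod>a\<in>S. [:- (\<zeta> ^ a * u i), v i:])"
  unfolding mask_map_def
proof (rule the_equality)
  fix q
  assume "\<exists>u' v'. (\<forall>i<m. u' i \<noteq> 0 \<or> v' i \<noteq> 0) \<and>
     form_point (\<Prod>i<m. [:- u i, v i:]) = form_point (\<Prod>i<m. [:- u' i, v' i:]) \<and>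
     q = form_point (\<Prod>i<m. \<Prod>a\<in>S. [:- (\<zeta> ^ a * u' i), v' i:])"
  then obtain u' v' where
    eq: "form_point (\<Prod>i<m. [:- u i, v i:]) = form_point (\<Prod>i<m. [:- u' i, v' i:])" and
    q: "q = form_point (\<Prod>i<m. \<Prod>a\<in>S. [:- (\<zeta> ^ a * u' i), v' i:])" by blast
  obtain c where c: "c \<noteq> 0"
    "(\<Prod>i<m. [:- u' i, v' i:]) = Polynomial.smult c (\<Prod>i<m. [:- u i, v i:])"
    using form_point_eqD[OF eq[symmetric]] by blast
  have "(\<Prod>i<m. [:- (b * u' i), v' i:]) = Polynomial.smult c (\<Prod>i<m. [:- (b * u i), v i:])" for b
    unfolding twist_form_linear_product[symmetric] c(2) by (rule twist_form_smult)
  then have "(\<Prod>a\<in>S. \<Prod>i<m. [:- (\<zeta> ^ a * u' i), v' i:]) =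
      (\<Prod>a\<in>S. Polynomial.smult c (\<Prod>i<m. [:- (\<zeta> ^ a * u i), v i:]))"
    by (simp only:)
  also have "\<dots> = Polynomial.smult (c ^ card S) (\<Prod>a\<in>S. \<Prod>i<m. [:- (\<zeta> ^ a * u i), v i:])"
    by (simp only: prod_smult prod_constant)
  finally have "(\<Prod>i<m. \<Prod>a\<in>S. [:- (\<zeta> ^ a * u' i), v' i:]) =
      Polynomial.smult (c ^ card S) (\<Prod>i<m. \<Prod>a\<in>S. [:- (\<zeta> ^ a * u i), v i:])"
    by (simp only: prod.swap[where A = "{..<m}" and B = S])
  then show "q = form_point (\<Prod>i<m. \<Prod>a\<in>S. [:- (\<zeta> ^ a * u i), v i:])"
    unfolding q using c(1) by (simp only: form_point_smult power_not_zero not_False_eq_True)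
qed (use assms in blast)

lemma linear_product_exists:
  fixes f :: "'k::alg_closed_field poly"
  assumes "f \<noteq> 0" "Polynomial.degree f \<le> m"
  shows "\<exists>u v c. c \<noteq> 0 \<and> (\<forall>i<m. u i \<noteq> 0 \<or> v i \<noteq> 0) \<and>
           f = Polynomial.smult c (\<Prod>i<m. [:- u i, v i:])"
  using assms
proof (induction m arbitrary: f)
  case 0
  then obtain a where "f = [:a:]" by (auto elim: degree_eq_zeroE)
  then show ?case using 0 by (auto intro!: exI[of _ a] simp: one_pCons)
next
  case (Suc m)
  have "\<exists>g a b. f = [:- a, b:] * g \<and> (a \<noteq> 0 \<or> b \<noteq> 0) \<and> Polynomial.degree g \<le> m"
  proof (cases "Polynomial.degree f \<le> m")
    case True
    then show ?thesis by (intro exI[of _ "- f"] exI[of _ 1] exI[of _ 0]) simp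
  next
    case False
    then obtain z where "poly f z = 0" using alg_closed_imp_poly_has_root[of f] by auto
    then obtain g where g: "f = [:- z, 1:] * g" unfolding poly_eq_0_iff_dvd by (rule dvdE)
    then have "g \<noteq> 0" using Suc.prems by auto
    then have "Polynomial.degree ([:- z, 1:] * g) = 1 + Polynomial.degree g"
      by (subst degree_mult_eq) simp_all
    then have "Polynomial.degree g \<le> m" using Suc.prems(2) unfolding g[symmetric] by linarith
    then show ?thesis using g by (intro exI[of _ g] exI[of _ z] exI[of _ 1] conjI) simp_all
  qed
  then obtain g a b where g: "f = [:- a, b:] * g" "a \<noteq> 0 \<or> b \<noteq> 0" "Polynomial.degree g \<le> m"
    by blast
  obtain u v c where *: "c \<noteq> 0" "\<forall>i<m. u i \<noteq> 0 \<or> v i \<noteq> 0"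
      "g = Polynomial.smult c (\<Prod>i<m. [:- u i, v i:])"
  proof -
    have "g \<noteq> 0" using Suc.prems(1) unfolding g(1) by (metis mult_zero_right)
    then show thesis using Suc.IH[OF _ g(3)] that by metis
  qed
  have "(\<Prod>i<Suc m. [:- (u(m := a)) i, (v(m := b)) i:]) = (\<Prod>i<m. [:- u i, v i:]) * [:- a, b:]"
    by (simp add: lessThan_Suc mult.commute del: mult_pCons_left mult_pCons_right)
  then have "f = Polynomial.smult c (\<Prod>i<Suc m. [:- (u(m := a)) i, (v(m := b)) i:])"
    unfolding g(1) *(3)
    by (simp only: mult_smult_left mult_smult_right mult.commute)
  moreover have "\<forall>i<Suc m. (u(m := a)) i \<noteq> 0 \<or> (v(m := b)) i \<noteq> 0"
    using *(2) g(2) by (auto simp: less_Suc_eq)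
  ultimately show ?case using *(1) by blast
qed

lemma proj_space_eq_linear_products:
  "proj_space m = {form_point (\<Prod>i<m. [:- u i, v i :: 'k::alg_closed_field:]) | u v.
     \<forall>i<m. u i \<noteq> 0 \<or> v i \<noteq> 0}" (is "_ = ?R")
proof (intro set_eqI iffI)
  fix p :: "(nat \<Rightarrow> 'k) set"
  assume "p \<in> proj_space m"
  then obtain x where x: "p = proj_point x" "\<forall>i>m. x i = 0" "\<exists>i. x i \<noteq> 0"
    by (auto simp: proj_space_def)
  define f where "f = (\<Sum>k\<le>m. Polynomial.monom (x k) k)"
  have f: "poly.coeff f = x" using x(2) by (auto simp: f_def coeff_sum fun_eq_iff)
  have "f \<noteq> 0" using f x(3) by auto
  moreover have "Polynomial.degree f \<le> m" using f x(2) by (intro degree_le) auto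
  ultimately obtain u v c where *: "c \<noteq> 0" "\<forall>i<m. u i \<noteq> 0 \<or> v i \<noteq> 0"
      "f = Polynomial.smult c (\<Prod>i<m. [:- u i, v i:])"
    using linear_product_exists by blast
  have "p = form_point f" by (simp add: form_point_def f x(1))
  then show "p \<in> ?R" using * form_point_smult[OF *(1)] by blast
next
  fix p :: "(nat \<Rightarrow> 'k) set"
  assume "p \<in> ?R"
  then obtain u v where p: "p = form_point (\<Prod>i<m. [:- u i, v i:])" and
    nz: "\<forall>i<m. u i \<noteq> 0 \<or> v i \<noteq> 0" by blast
  have "(\<Prod>i<m. [:- u i, v i:]) \<noteq> 0" using nz by auto
  then have "\<exists>k. poly.coeff (\<Prod>i<m. [:- u i, v i:]) k \<noteq> 0" by (auto simp: poly_eq_iff)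
  moreover have "\<forall>k>m. poly.coeff (\<Prod>i<m. [:- u i, v i:]) k = 0"
    using le_less_trans[OF degree_linear_product[of u v m]] by (auto intro: coeff_eq_0)
  ultimately show "p \<in> proj_space m" unfolding p form_point_def proj_space_def by blast
qed

end

theory Submission
  imports Defs "HOL-Number_Theory.Cong"
begin

text \<open>
  Write $g=\nu_S(f)$ and $h=\nu_T(f)$, and let $g_z$ be $g$ with all roots multiplied by a $d$th root of
  unity $z$. Up to constants, $g$ and $h$ are the products over $S$ and over $T$ of the rotations
  of $f$, so passing from $f$ to $g$ or $h$ is, on logarithmic derivatives, convolution with the indicator
  of $S$ or $T$ on $C_d$.

  If $Z(S)\subseteq Z(T)$, Fourier inversion writes the indicator of $T$ as a convolution $c*1_S$ with
  coefficients $c_z\in K$ (\<open>mask_transfer_kernel\<close>). Hence $h'/h=\sum_zc_z\,g_z'/g_z$; formally,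
  $h=\prod_zg_z^{c_z}$ with exponents in $K$. Near a point $\xi$ that is not a root of any $g_z$ this
  is a regular first-order linear differential equation for $h$. Its power series solution is unique
  up to a scalar; normalized to the value $1$ at $\xi$, it has as coefficients polynomials in the
  coefficients of $g$ divided by powers of $\prod_zg_z(\xi)$ (\<open>first_order_ode_coeffs\<close>). Since $h$ has bounded degree, finitely
  many coefficients determine it, so $h$ is a regular function of $g$ on the open set where
  $\prod_zg_z(\xi)\ne0$, and these sets cover $Y_{S,m}$ as $\xi$ varies
  (\<open>mask_map_factors_locally\<close>). This gives a morphism $Y_{S,m}\to Y_{T,m}$ compatible with
  $\nu_S$ and $\nu_T$; if $Z(S)=Z(T)$, there is one in each direction and they are mutually
  inverse. Uniqueness holds because $\nu_S$ is surjective onto $Y_{S,m}$.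

  For the converse, let $\lambda_j(S)=0$, $e=\gcd(j,d)$ and $n=d/e$. The values $\lambda_k(S)$ with
  $\gcd(k,d)=e$ are conjugate over the rationals, so they all vanish
  (\<open>int_poly_root_conjugate\<close>, the irreducibility of cyclotomic polynomials in disguise). The
  integral combination of roots of unity with generating polynomial
  $\sum_{i<e}x^{ni}\cdot\prod_{p\mid n}(1-x^{n/p})$ has Fourier transform supported exactly at these $k$.
  It is a difference of two effective divisors of degree $e\,2^{r-1}\le b(d)\le m$, where $r$ is the
  number of primes dividing $n$, and $\nu_S$ therefore identifies these divisors. If $\nu_T$ factors through $\nu_S$, it identifies them as well, and then the
  transform of $T$ must vanish at $j$ (\<open>factorization_imp_mask_zeros_subset\<close>).
\<close>

section \<open>Homogeneous functions of the coordinates\<close>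

text \<open>
  Homogeneous polynomials are handled through the functions that they induce on coordinate vectors,
  since a morphism is prescribed by values and the closure properties below are then statements
  about pointwise sums and products.
\<close>
definition homogeneous_fun :: "nat \<Rightarrow> nat \<Rightarrow> ((nat \<Rightarrow> 'k::field) \<Rightarrow> 'k) \<Rightarrow> bool" where
  "homogeneous_fun n e F \<longleftrightarrow> (\<exists>f. homogeneous_poly n e f \<and> (\<forall>x. mvpoly_eval f x = F x))"

lemma mvpoly_eval_superset:
  assumes "finite A" "Poly_Mapping.keys f \<subseteq> A"
  shows "mvpoly_eval f x = (\<Sum>\<alpha>\<in>A. Poly_Mapping.lookup f \<alpha> *
           (\<Prod>i\<in>Poly_Mapping.keys \<alpha>. x i ^ Poly_Mapping.lookup \<alpha> i))"
  unfolding mvpoly_eval_def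
  by (rule sum.mono_neutral_left) (use assms in \<open>auto simp: in_keys_iff\<close>)

lemma mvpoly_eval_add: "mvpoly_eval (f + g) x = mvpoly_eval f x + mvpoly_eval g x"
proof -
  let ?A = "Poly_Mapping.keys f \<union> Poly_Mapping.keys g"
  have "Poly_Mapping.keys (f + g) \<subseteq> ?A" by (rule keys_add)
  then show ?thesis
    by (subst (1 2 3) mvpoly_eval_superset[of ?A])
      (auto simp: lookup_add sum.distrib algebra_simps)
qed

lemma mvpoly_eval_single:
  "mvpoly_eval (Poly_Mapping.single \<alpha> c) x =
     c * (\<Prod>i\<in>Poly_Mapping.keys \<alpha>. x i ^ Poly_Mapping.lookup \<alpha> i)"
  by (subst mvpoly_eval_superset[of "{\<alpha>}"]) auto

lemma homogeneous_fun_add: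
  assumes "homogeneous_fun n e F" "homogeneous_fun n e G"
  shows "homogeneous_fun n e (\<lambda>x. F x + G x)"
proof -
  obtain f g where f: "homogeneous_poly n e f" "\<And>x. mvpoly_eval f x = F x"
    and g: "homogeneous_poly n e g" "\<And>x. mvpoly_eval g x = G x"
    using assms unfolding homogeneous_fun_def by blast
  have "homogeneous_poly n e (f + g)"
    using f(1) g(1) keys_add[of f g] unfolding homogeneous_poly_def by blast
  then show ?thesis
    unfolding homogeneous_fun_def using f(2) g(2) by (intro exI[of _ "f + g"]) (simp add: mvpoly_eval_add)
qed

lemma homogeneous_fun_zero: "homogeneous_fun n e (\<lambda>x. 0)"
  unfolding homogeneous_fun_def homogeneous_poly_def mvpoly_eval_def
  by (intro exI[of _ 0]) simp

lemma homogeneous_fun_sum: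
  assumes "\<And>i. i \<in> I \<Longrightarrow> homogeneous_fun n e (F i)"
  shows "homogeneous_fun n e (\<lambda>x. \<Sum>i\<in>I. F i x)"
  using assms
  by (induction I rule: infinite_finite_induct) (auto intro: homogeneous_fun_add homogeneous_fun_zero)

lemma homogeneous_fun_monomial:
  assumes "Poly_Mapping.keys \<alpha> \<subseteq> {..n}" "(\<Sum>i\<in>Poly_Mapping.keys \<alpha>. Poly_Mapping.lookup \<alpha> i) = e"
  shows "homogeneous_fun n e (\<lambda>x. c * (\<Prod>i\<in>Poly_Mapping.keys \<alpha>. x i ^ Poly_Mapping.lookup \<alpha> i))"
  unfolding homogeneous_fun_def homogeneous_poly_def
  by (intro exI[of _ "Poly_Mapping.single \<alpha> c"])
    (use assms in \<open>auto simp: mvpoly_eval_single\<close>)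

lemma homogeneous_fun_const: "homogeneous_fun n 0 (\<lambda>x. c)"
  using homogeneous_fun_monomial[of 0 n 0 c] by simp

lemma homogeneous_fun_coordinate:
  assumes "i \<le> n"
  shows "homogeneous_fun n 1 (\<lambda>x. x i)"
  using homogeneous_fun_monomial[of "Poly_Mapping.single i 1" n 1 1] assms by simp

lemma homogeneous_fun_mult:
  assumes "homogeneous_fun n e F" "homogeneous_fun n e' G"
  shows "homogeneous_fun n (e + e') (\<lambda>x. F x * G x)"
proof -
  define M :: "(nat \<Rightarrow>\<^sub>0 nat) \<Rightarrow> (nat \<Rightarrow> 'a) \<Rightarrow> 'a" where
    "M \<alpha> x = (\<Prod>i\<in>Poly_Mapping.keys \<alpha>. x i ^ Poly_Mapping.lookup \<alpha> i)" for \<alpha> x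
  obtain f g where f: "homogeneous_poly n e f" "\<And>x. mvpoly_eval f x = F x"
    and g: "homogeneous_poly n e' g" "\<And>x. mvpoly_eval g x = G x"
    using assms unfolding homogeneous_fun_def by blast
  have M_add: "M (\<alpha> + \<beta>) x = M \<alpha> x * M \<beta> x" for \<alpha> \<beta> x
  proof -
    let ?A = "Poly_Mapping.keys \<alpha> \<union> Poly_Mapping.keys \<beta>"
    have M: "M \<gamma> x = (\<Prod>i\<in>?A. x i ^ Poly_Mapping.lookup \<gamma> i)" if "Poly_Mapping.keys \<gamma> \<subseteq> ?A" for \<gamma>
      unfolding M_def by (rule prod.mono_neutral_left) (use that in \<open>auto simp: in_keys_iff\<close>)
    show ?thesis
      using keys_add[of \<alpha> \<beta>] by (simp add: M lookup_add power_add prod.distrib)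
  qed
  have deg_add: "(\<Sum>i\<in>Poly_Mapping.keys (\<alpha> + \<beta>). Poly_Mapping.lookup (\<alpha> + \<beta>) i) =
      (\<Sum>i\<in>Poly_Mapping.keys \<alpha>. Poly_Mapping.lookup \<alpha> i) +
      (\<Sum>i\<in>Poly_Mapping.keys \<beta>. Poly_Mapping.lookup \<beta> i)" for \<alpha> \<beta> :: "nat \<Rightarrow>\<^sub>0 nat"
  proof -
    let ?A = "Poly_Mapping.keys \<alpha> \<union> Poly_Mapping.keys \<beta>"
    have S: "(\<Sum>i\<in>Poly_Mapping.keys \<gamma>. Poly_Mapping.lookup \<gamma> i) = (\<Sum>i\<in>?A. Poly_Mapping.lookup \<gamma> i)"
      if "Poly_Mapping.keys \<gamma> \<subseteq> ?A" for \<gamma> :: "nat \<Rightarrow>\<^sub>0 nat"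
      by (rule sum.mono_neutral_left) (use that in \<open>auto simp: in_keys_iff\<close>)
    show ?thesis
      unfolding S[OF keys_add] S[OF Un_upper1] S[OF Un_upper2] by (simp add: lookup_add sum.distrib)
  qed
  \<comment> \<open>Expanded, the product is a sum of monomials with added exponents, which the closure under
    sums covers.\<close>
  have "F x * G x = (\<Sum>\<alpha>\<in>Poly_Mapping.keys f. \<Sum>\<beta>\<in>Poly_Mapping.keys g.
      (Poly_Mapping.lookup f \<alpha> * Poly_Mapping.lookup g \<beta>) * M (\<alpha> + \<beta>) x)" for x
    unfolding f(2)[symmetric] g(2)[symmetric] mvpoly_eval_def sum_product M_add
    by (intro sum.cong refl) (simp add: M_def mult_ac)
  moreover have "homogeneous_fun n (e + e')
      (\<lambda>x. (Poly_Mapping.lookup f \<alpha> * Poly_Mapping.lookup g \<beta>) * M (\<alpha> + \<beta>) x)"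
    if "\<alpha> \<in> Poly_Mapping.keys f" "\<beta> \<in> Poly_Mapping.keys g" for \<alpha> \<beta>
  proof -
    have "Poly_Mapping.keys (\<alpha> + \<beta>) \<subseteq> {..n}"
      using f(1) g(1) that keys_add[of \<alpha> \<beta>] unfolding homogeneous_poly_def by blast
    moreover have "(\<Sum>i\<in>Poly_Mapping.keys (\<alpha> + \<beta>). Poly_Mapping.lookup (\<alpha> + \<beta>) i) = e + e'"
      using f(1) g(1) that unfolding homogeneous_poly_def deg_add by simp
    ultimately show ?thesis unfolding M_def by (rule homogeneous_fun_monomial)
  qed
  ultimately show ?thesis by (simp add: homogeneous_fun_sum)
qed

lemma homogeneous_fun_cmult:
  assumes "homogeneous_fun n e F"
  shows "homogeneous_fun n e (\<lambda>x. c * F x)"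
  using homogeneous_fun_mult[OF homogeneous_fun_const assms, of c] by simp

lemma homogeneous_fun_power:
  assumes "homogeneous_fun n e F"
  shows "homogeneous_fun n (e * k) (\<lambda>x. F x ^ k)"
proof (induction k)
  case (Suc k)
  then show ?case using homogeneous_fun_mult[OF assms Suc] by simp
qed (simp add: homogeneous_fun_const)

text \<open>
  The value scales with the representative, so that whether it vanishes depends only on the point.
\<close>
lemma homogeneous_fun_scale:
  assumes "homogeneous_fun n e F"
  shows "F (\<lambda>i. c * x i) = c ^ e * F x"
proof -
  obtain f where f: "homogeneous_poly n e f" "\<And>x. mvpoly_eval f x = F x"
    using assms unfolding homogeneous_fun_def by blast
  have "(\<Prod>i\<in>Poly_Mapping.keys \<alpha>. (c * x i) ^ Poly_Mapping.lookup \<alpha> i) =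
      c ^ e * (\<Prod>i\<in>Poly_Mapping.keys \<alpha>. x i ^ Poly_Mapping.lookup \<alpha> i)"
    if "\<alpha> \<in> Poly_Mapping.keys f" for \<alpha>
    using f(1) that unfolding homogeneous_poly_def
    by (simp add: power_mult_distrib prod.distrib flip: power_sum)
  then show ?thesis
    unfolding f(2)[symmetric] mvpoly_eval_def sum_distrib_left
    by (intro sum.cong) auto
qed

section \<open>Polynomials with homogeneous coefficients and first-order equations\<close>

text \<open>
  Here \<open>\<Phi> x\<close> is a polynomial in an auxiliary variable $t$ whose coefficients depend on a point $x$;
  the degree $e$ is the degree in $x$.
\<close>
definition homogeneous_poly_family ::
  "nat \<Rightarrow> nat \<Rightarrow> ((nat \<Rightarrow> 'k::field) \<Rightarrow> 'k poly) \<Rightarrow> bool" where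
  "homogeneous_poly_family n e \<Phi> \<longleftrightarrow> (\<forall>k. homogeneous_fun n e (\<lambda>x. poly.coeff (\<Phi> x) k))"

lemma homogeneous_poly_family_linear:
  "homogeneous_poly_family n 1 (\<lambda>x. \<Sum>k\<le>n. Polynomial.smult (x k) (B k))"
  unfolding homogeneous_poly_family_def coeff_sum coeff_smult
proof (intro allI homogeneous_fun_sum)
  fix k i assume "i \<in> {..n}"
  then show "homogeneous_fun n 1 (\<lambda>x. x i * poly.coeff (B i) k)"
    using homogeneous_fun_cmult[OF homogeneous_fun_coordinate, of i n "poly.coeff (B i) k"]
    by (simp add: mult.commute)
qed

lemma homogeneous_poly_family_mult:
  assumes "homogeneous_poly_family n e \<Phi>" "homogeneous_poly_family n e' \<Psi>"
  shows "homogeneous_poly_family n (e + e') (\<lambda>x. \<Phi> x * \<Psi> x)"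
  using assms unfolding homogeneous_poly_family_def coeff_mult
  by (auto intro!: homogeneous_fun_sum homogeneous_fun_mult)

lemma homogeneous_poly_family_sum:
  assumes "\<And>i. i \<in> I \<Longrightarrow> homogeneous_poly_family n e (\<Phi> i)"
  shows "homogeneous_poly_family n e (\<lambda>x. \<Sum>i\<in>I. \<Phi> i x)"
  using assms unfolding homogeneous_poly_family_def coeff_sum
  by (auto intro!: homogeneous_fun_sum)

lemma homogeneous_poly_family_smult:
  assumes "homogeneous_poly_family n e \<Phi>"
  shows "homogeneous_poly_family n e (\<lambda>x. Polynomial.smult c (\<Phi> x))"
  using assms unfolding homogeneous_poly_family_def coeff_smult
  by (auto intro!: homogeneous_fun_cmult)

lemma homogeneous_poly_family_pderiv:
  assumes "homogeneous_poly_family n e \<Phi>"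
  shows "homogeneous_poly_family n e (\<lambda>x. pderiv (\<Phi> x))"
  using assms unfolding homogeneous_poly_family_def coeff_pderiv
  by (auto intro!: homogeneous_fun_cmult)

lemma homogeneous_poly_family_prod:
  fixes \<Phi> :: "'i \<Rightarrow> (nat \<Rightarrow> 'k::field) \<Rightarrow> 'k poly"
  assumes "finite I" "\<And>i. i \<in> I \<Longrightarrow> homogeneous_poly_family n e (\<Phi> i)"
  shows "homogeneous_poly_family n (e * card I) (\<lambda>x. \<Prod>i\<in>I. \<Phi> i x)"
  using assms
proof (induction I rule: finite_induct)
  case empty
  have "homogeneous_fun n 0 (\<lambda>x::nat \<Rightarrow> 'k. poly.coeff 1 k)" for k
    by (rule homogeneous_fun_const)
  then show ?case by (simp add: homogeneous_poly_family_def)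
next
  case (insert i I)
  then show ?case using homogeneous_poly_family_mult[of n e "\<Phi> i" "e * card I"] by simp
qed

text \<open>
  Compare coefficients of $t^k$ in $h'P = hQ$: this gives $(k+1)\,h_{k+1}p_0$ in terms of
  $h_0,\dots,h_k$. Clearing the powers of $p_0$ that earlier steps introduced keeps everything
  homogeneous, and the only division is by $k+1$, which characteristic zero permits.
\<close>
lemma first_order_ode_coeffs:
  fixes P Q :: "(nat \<Rightarrow> 'k::field_char_0) \<Rightarrow> 'k poly"
  assumes P: "homogeneous_poly_family n e P" and Q: "homogeneous_poly_family n e Q"
  shows "\<exists>H. homogeneous_fun n (e * k) H \<and>
    (\<forall>x h. pderiv h * P x = h * Q x \<longrightarrow>
       poly.coeff h k * poly.coeff (P x) 0 ^ k = poly.coeff h 0 * H x)"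
proof (induction k rule: less_induct)
  case (less k)
  show ?case
  proof (cases k)
    case 0
    then show ?thesis by (intro exI[of _ "\<lambda>x. 1"]) (simp add: homogeneous_fun_const)
  next
    case (Suc l)
    define p where "p i x = poly.coeff (P x) i" for i x
    define q where "q i x = poly.coeff (Q x) i" for i x
    have p: "homogeneous_fun n e (p i)" and q: "homogeneous_fun n e (q i)" for i
      using P Q unfolding homogeneous_poly_family_def p_def q_def by auto
    have "\<forall>i. \<exists>H. i \<le> l \<longrightarrow> homogeneous_fun n (e * i) H \<and>
        (\<forall>x h. pderiv h * P x = h * Q x \<longrightarrow> poly.coeff h i * p 0 x ^ i = poly.coeff h 0 * H x)"
      using less.IH Suc unfolding p_def by (metis less_Suc_eq_le)
    then obtain H where H: "\<And>i. i \<le> l \<Longrightarrow> homogeneous_fun n (e * i) (H i)"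
      and eq: "\<And>i x h. i \<le> l \<Longrightarrow> pderiv h * P x = h * Q x \<Longrightarrow>
          poly.coeff h i * p 0 x ^ i = poly.coeff h 0 * H i x"
      by metis
    define R where "R x = inverse (of_nat (Suc l)) *
        ((\<Sum>i\<le>l. (H i x * p 0 x ^ (l - i)) * q (l - i) x) +
         (\<Sum>i<l. (- of_nat (Suc i)) * ((H (Suc i) x * p 0 x ^ (l - Suc i)) * p (l - i) x)))" for x
    have "homogeneous_fun n (e * k) (\<lambda>x. (H i x * p 0 x ^ (l - i)) * q (l - i) x)" if "i \<le> l" for i
    proof -
      have "e * k = (e * i + e * (l - i)) + e"
        using that Suc by (simp flip: distrib_left)
      then show ?thesis
        using homogeneous_fun_mult[OF homogeneous_fun_mult[OF H[OF that]
              homogeneous_fun_power[OF p]] q] by simp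
    qed
    moreover have "homogeneous_fun n (e * k) (\<lambda>x. (H (Suc i) x * p 0 x ^ (l - Suc i)) * p (l - i) x)"
      if "i < l" for i
    proof -
      have "e * k = (e * Suc i + e * (l - Suc i)) + e"
        using that Suc unfolding distrib_left[symmetric] by simp
      then show ?thesis
        using homogeneous_fun_mult[OF homogeneous_fun_mult[OF H
              homogeneous_fun_power[OF p]] p, of "Suc i"] that by simp
    qed
    ultimately have "homogeneous_fun n (e * k) R"
      unfolding R_def
      by (intro homogeneous_fun_cmult homogeneous_fun_add homogeneous_fun_sum) auto
    moreover have "poly.coeff h k * p 0 x ^ k = poly.coeff h 0 * R x"
      if ode: "pderiv h * P x = h * Q x" for x h
    proof -
      have 1: "poly.coeff (pderiv h * P x) l =
          (\<Sum>i<l. of_nat (Suc i) * poly.coeff h (Suc i) * p (l - i) x) +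
          of_nat (Suc l) * poly.coeff h (Suc l) * p 0 x"
        unfolding coeff_mult coeff_pderiv p_def by (simp add: lessThan_Suc_atMost[symmetric])
      have 2: "poly.coeff (h * Q x) l = (\<Sum>i\<le>l. poly.coeff h i * q (l - i) x)"
        unfolding coeff_mult q_def by simp
      have "of_nat (Suc l) * poly.coeff h (Suc l) * p 0 x =
          (\<Sum>i\<le>l. poly.coeff h i * q (l - i) x) +
          (\<Sum>i<l. (- of_nat (Suc i)) * (poly.coeff h (Suc i) * p (l - i) x))"
      proof -
        have "(\<Sum>i<l. (- of_nat (Suc i)) * (poly.coeff h (Suc i) * p (l - i) x)) =
            - (\<Sum>i<l. of_nat (Suc i) * poly.coeff h (Suc i) * p (l - i) x)"
          unfolding sum_negf[symmetric] by (intro sum.cong) (simp_all del: of_nat_Suc)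
        then show ?thesis using 1 2 ode by (simp del: of_nat_Suc add: eq_diff_eq add.commute)
      qed
      then have "of_nat (Suc l) * (poly.coeff h (Suc l) * p 0 x ^ Suc l) =
          ((\<Sum>i\<le>l. poly.coeff h i * q (l - i) x) +
          (\<Sum>i<l. (- of_nat (Suc i)) * (poly.coeff h (Suc i) * p (l - i) x))) * p 0 x ^ l"
        by (simp add: mult_ac)
      also have "\<dots> = (\<Sum>i\<le>l. (poly.coeff h i * p 0 x ^ i) * p 0 x ^ (l - i) * q (l - i) x) +
          (\<Sum>i<l. (- of_nat (Suc i)) *
             ((poly.coeff h (Suc i) * p 0 x ^ Suc i) * p 0 x ^ (l - Suc i) * p (l - i) x))"
        unfolding distrib_right sum_distrib_right
      proof (intro arg_cong2[of _ _ _ _ "(+)"] sum.cong refl)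
        fix i assume "i \<in> {..l}"
        then have "p 0 x ^ l = p 0 x ^ i * p 0 x ^ (l - i)" by (simp flip: power_add)
        then show "poly.coeff h i * q (l - i) x * p 0 x ^ l =
            (poly.coeff h i * p 0 x ^ i) * p 0 x ^ (l - i) * q (l - i) x" by (simp add: mult_ac)
      next
        fix i assume "i \<in> {..<l}"
        then have "p 0 x ^ l = p 0 x ^ Suc i * p 0 x ^ (l - Suc i)"
          unfolding power_add[symmetric] by simp
        then show "(- of_nat (Suc i)) * (poly.coeff h (Suc i) * p (l - i) x) * p 0 x ^ l =
            (- of_nat (Suc i)) *
             ((poly.coeff h (Suc i) * p 0 x ^ Suc i) * p 0 x ^ (l - Suc i) * p (l - i) x)"
          by (simp only: mult_ac)
      qed
      also have "\<dots> = (\<Sum>i\<le>l. (poly.coeff h 0 * H i x) * p 0 x ^ (l - i) * q (l - i) x) +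
          (\<Sum>i<l. (- of_nat (Suc i)) *
             ((poly.coeff h 0 * H (Suc i) x) * p 0 x ^ (l - Suc i) * p (l - i) x))"
        by (intro arg_cong2[of _ _ _ _ "(+)"] sum.cong refl) (simp_all only: eq[OF _ ode] atMost_iff lessThan_iff Suc_leI)
      also have "\<dots> = poly.coeff h 0 * (of_nat (Suc l) * R x)"
        unfolding R_def mult.assoc[of "of_nat _" "inverse _", symmetric]
        by (simp del: of_nat_Suc add: distrib_left sum_distrib_left mult_ac)
      also have "\<dots> = of_nat (Suc l) * (poly.coeff h 0 * R x)" by (rule mult.left_commute)
      finally have "poly.coeff h (Suc l) * p 0 x ^ Suc l = poly.coeff h 0 * R x"
        unfolding mult_cancel_left of_nat_eq_0_iff by simp
      then show ?thesis unfolding Suc .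
    qed
    ultimately show ?thesis unfolding p_def by blast
  qed
qed

section \<open>Convolution on the group of roots of unity\<close>

lemma finite_roots_of_unity:
  assumes "d > 0"
  shows "finite {z :: 'k::idom. z ^ d = 1}"
proof -
  have "Polynomial.degree (Polynomial.monom 1 d - 1 :: 'k poly) = d"
    using assms degree_add_eq_left[of "- 1" "Polynomial.monom 1 d :: 'k poly"]
    by (simp add: degree_monom_eq)
  then have "Polynomial.monom 1 d - 1 \<noteq> (0 :: 'k poly)" using assms by auto
  from poly_roots_finite[OF this] show ?thesis by (simp add: poly_monom)
qed

lemma sum_powers_root_of_unity:
  fixes w :: "'k::field"
  assumes "w ^ d = 1"
  shows "(\<Sum>k<d. w ^ k) = (if w = 1 then of_nat d else 0)"
  using assms by (simp add: geometric_sum)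

text \<open>
  On the group of $d$th roots of unity, the indicator of $T$ is a convolution multiple of the
  indicator of $S$ as soon as its Fourier transform vanishes wherever that of $S$ does: divide the
  transforms and invert.
\<close>
lemma mask_transfer_kernel:
  fixes \<zeta> :: "'k::field_char_0"
  assumes d: "d > 0" and \<zeta>: "\<zeta> ^ d = 1"
    and ZST: "mask_zeros d \<zeta> S \<subseteq> mask_zeros d \<zeta> T"
  shows "\<exists>c. \<forall>W :: 'k \<Rightarrow> 'k.
    (\<Sum>z | z ^ d = 1. c z * (\<Sum>a\<in>S. W (\<zeta> ^ a * z))) = (\<Sum>t\<in>T. W (\<zeta> ^ t))"
proof -
  let ?\<mu> = "{z :: 'k. z ^ d = 1}"
  have fin: "finite ?\<mu>" using d by (rule finite_roots_of_unity)
  have nz: "\<zeta> \<noteq> 0" using \<zeta> d by (auto simp: power_0_left)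
  define \<rho> where "\<rho> k = (if mask_eigenvalue \<zeta> S k = 0 then 0
      else mask_eigenvalue \<zeta> T k / mask_eigenvalue \<zeta> S k)" for k
  have \<rho>: "\<rho> k * mask_eigenvalue \<zeta> S k = mask_eigenvalue \<zeta> T k" if "k < d" for k
    using ZST that by (auto simp: \<rho>_def mask_zeros_def)
  define c where "c z = inverse (of_nat d) * (\<Sum>k<d. \<rho> k * inverse z ^ k)" for z
  have "(\<Sum>z\<in>?\<mu>. c z * (\<Sum>a\<in>S. W (\<zeta> ^ a * z))) = (\<Sum>t\<in>T. W (\<zeta> ^ t))" for W :: "'k \<Rightarrow> 'k"
  proof -
    define V where "V k = (\<Sum>z\<in>?\<mu>. inverse z ^ k * W z)" for k
    have \<zeta>a: "(\<zeta> ^ a) ^ d = 1" for a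
      by (metis \<zeta> mult.commute power_mult power_one)
    have shift: "(\<Sum>z\<in>?\<mu>. inverse z ^ k * W (\<zeta> ^ a * z)) = \<zeta> ^ (a * k) * V k" for a k
    proof -
      have "(\<Sum>z\<in>?\<mu>. inverse z ^ k * W (\<zeta> ^ a * z)) =
          (\<Sum>z\<in>?\<mu>. \<zeta> ^ (a * k) * (inverse z ^ k * W z))"
        by (rule sum.reindex_bij_witness[of _ "\<lambda>z. z / \<zeta> ^ a" "\<lambda>z. \<zeta> ^ a * z"])
          (use nz \<zeta>a in \<open>auto simp: power_mult power_mult_distrib power_divide field_simps\<close>)
      then show ?thesis by (simp add: V_def sum_distrib_left)
    qed
    have "(\<Sum>z\<in>?\<mu>. c z * (\<Sum>a\<in>S. W (\<zeta> ^ a * z))) =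
        inverse (of_nat d) * (\<Sum>z\<in>?\<mu>. \<Sum>k<d. \<Sum>a\<in>S. \<rho> k * (inverse z ^ k * W (\<zeta> ^ a * z)))"
      by (simp add: c_def sum_distrib_left sum_distrib_right mult.assoc)
        (intro sum.cong refl sum.swap)
    also have "(\<Sum>z\<in>?\<mu>. \<Sum>k<d. \<Sum>a\<in>S. \<rho> k * (inverse z ^ k * W (\<zeta> ^ a * z))) =
        (\<Sum>k<d. \<Sum>a\<in>S. \<rho> k * (\<Sum>z\<in>?\<mu>. inverse z ^ k * W (\<zeta> ^ a * z)))"
      unfolding sum_distrib_left
      by (subst sum.swap) (intro sum.cong refl sum.swap)
    also have "\<dots> = (\<Sum>k<d. (\<rho> k * mask_eigenvalue \<zeta> S k) * V k)"
      unfolding shift by (simp add: mask_eigenvalue_def sum_distrib_left sum_distrib_right mult.assoc)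
    also have "\<dots> = (\<Sum>k<d. mask_eigenvalue \<zeta> T k * V k)"
      using \<rho> by (intro sum.cong) auto
    also have "\<dots> = (\<Sum>k<d. \<Sum>t\<in>T. \<Sum>z\<in>?\<mu>. (\<zeta> ^ t * inverse z) ^ k * W z)"
      by (simp add: mask_eigenvalue_def V_def sum_distrib_left sum_distrib_right
          power_mult power_mult_distrib mult.assoc)
        (intro sum.cong refl sum.swap)
    also have "\<dots> = (\<Sum>t\<in>T. \<Sum>z\<in>?\<mu>. (\<Sum>k<d. (\<zeta> ^ t * inverse z) ^ k) * W z)"
      unfolding sum_distrib_right
      by (subst sum.swap) (intro sum.cong refl sum.swap)
    also have "\<dots> = (\<Sum>t\<in>T. \<Sum>z\<in>?\<mu>. if z = \<zeta> ^ t then of_nat d * W z else 0)"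
    proof (intro sum.cong refl)
      fix t z assume "z \<in> ?\<mu>"
      then have "z \<noteq> 0" "(\<zeta> ^ t * inverse z) ^ d = 1"
        using d \<zeta>a by (auto simp: power_mult_distrib power_inverse power_0_left)
      moreover from this have "\<zeta> ^ t * inverse z = 1 \<longleftrightarrow> z = \<zeta> ^ t" by (auto simp: field_simps)
      ultimately show "(\<Sum>k<d. (\<zeta> ^ t * inverse z) ^ k) * W z = (if z = \<zeta> ^ t then of_nat d * W z else 0)"
        by (simp only: sum_powers_root_of_unity split: if_splits) simp
    qed
    also have "\<dots> = (\<Sum>t\<in>T. of_nat d * W (\<zeta> ^ t))"
      using fin \<zeta>a by (simp add: sum.delta)
    also have "\<dots> = of_nat d * (\<Sum>t\<in>T. W (\<zeta> ^ t))" by (simp add: sum_distrib_left)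
    finally show ?thesis using d by simp
  qed
  then show ?thesis by blast
qed

section \<open>Logarithmic derivatives of mask forms\<close>

lemma degree_prod_linear:
  assumes "finite I"
  shows "Polynomial.degree (\<Prod>i\<in>I. [:- r i, s i:]) \<le> card I"
  using assms
proof (induction I rule: finite_induct)
  case (insert i I)
  have "Polynomial.degree [:- r i, s i:] \<le> 1" by simp
  with insert show ?case
    using degree_mult_le[of "[:- r i, s i:]" "\<Prod>i\<in>I. [:- r i, s i:]"] by simp
qed simp

lemma twist_form_prod_linear:
  assumes "finite I"
  shows "twist_form (card I) c (\<Prod>i\<in>I. [:- r i, s i:]) = (\<Prod>i\<in>I. [:- (c * r i), s i:])"
  using assms
proof (induction I rule: finite_induct)
  case empty
  show ?case by (rule poly_eqI) (auto simp: coeff_twist_form)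
next
  case (insert i I)
  then show ?case
    using twist_form_linear_mult[OF degree_prod_linear[OF insert.hyps(1)], of c "r i" "s i" r s]
    by (simp del: mult_pCons_left)
qed

lemma poly_pderiv_prod_linear:
  fixes r s :: "'i \<Rightarrow> 'k::field"
  assumes "finite I" "\<And>i. i \<in> I \<Longrightarrow> s i * X - r i \<noteq> 0"
  shows "poly (pderiv (\<Prod>i\<in>I. [:- r i, s i:])) X =
           poly (\<Prod>i\<in>I. [:- r i, s i:]) X * (\<Sum>i\<in>I. s i / (s i * X - r i))"
  using assms
proof (induction I rule: finite_induct)
  case (insert i I)
  then have nz: "s i * X - r i \<noteq> 0" by simp
  let ?f = "\<Prod>i\<in>I. [:- r i, s i:]"
  have "poly (pderiv ([:- r i, s i:] * ?f)) X = s i * poly ?f X + (s i * X - r i) * poly (pderiv ?f) X"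
    unfolding pderiv_mult poly_add poly_mult by (simp add: pderiv_pCons algebra_simps)
  also have "\<dots> = (s i * X - r i) * poly ?f X * (s i / (s i * X - r i) + (\<Sum>i\<in>I. s i / (s i * X - r i)))"
    using insert nz by (simp add: distrib_left)
  also have "(s i * X - r i) * poly ?f X = poly ([:- r i, s i:] * ?f) X" by (simp add: algebra_simps)
  finally show ?case unfolding prod.insert[OF insert.hyps] sum.insert[OF insert.hyps] .
qed simp

text \<open>
  Clearing denominators in $h'/h = \sum_z c_z\, g_z'/g_z$; points outside the zeros of $h$ and the
  $g_z$ determine a polynomial.
\<close>
lemma log_derivative_clear_denominators:
  fixes g :: "'i \<Rightarrow> 'k::field_char_0 poly"
  assumes fin: "finite M" and nz: "h \<noteq> 0" "\<And>z. z \<in> M \<Longrightarrow> g z \<noteq> 0"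
    and log: "\<And>X. poly h X \<noteq> 0 \<Longrightarrow> (\<And>z. z \<in> M \<Longrightarrow> poly (g z) X \<noteq> 0) \<Longrightarrow>
      poly (pderiv h) X / poly h X = (\<Sum>z\<in>M. c z * (poly (pderiv (g z)) X / poly (g z) X))"
  shows "pderiv h * (\<Prod>z\<in>M. g z) =
    h * (\<Sum>z\<in>M. Polynomial.smult (c z) (pderiv (g z) * (\<Prod>y\<in>M - {z}. g y)))"
proof -
  let ?L = "pderiv h * (\<Prod>z\<in>M. g z)"
  let ?R = "h * (\<Sum>z\<in>M. Polynomial.smult (c z) (pderiv (g z) * (\<Prod>y\<in>M - {z}. g y)))"
  have "poly ((?L - ?R) * (h * (\<Prod>z\<in>M. g z))) X = 0" for X
  proof (cases "poly (h * (\<Prod>z\<in>M. g z)) X = 0")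
    case False
    then have h: "poly h X \<noteq> 0" and g: "\<And>z. z \<in> M \<Longrightarrow> poly (g z) X \<noteq> 0"
      using fin by (auto simp: poly_prod)
    have "poly ?R X = poly h X * (\<Sum>z\<in>M. c z * (poly (pderiv (g z)) X / poly (g z) X) *
        (\<Prod>y\<in>M. poly (g y) X))"
      unfolding poly_mult poly_sum poly_smult poly_prod
    proof (rule arg_cong[of _ _ "(*) _"], rule sum.cong[OF refl])
      fix z assume z: "z \<in> M"
      have "(\<Prod>y\<in>M. poly (g y) X) = poly (g z) X * (\<Prod>y\<in>M - {z}. poly (g y) X)"
        using fin z by (rule prod.remove)
      then show "c z * (poly (pderiv (g z)) X * (\<Prod>y\<in>M - {z}. poly (g y) X)) =
          c z * (poly (pderiv (g z)) X / poly (g z) X) * (\<Prod>y\<in>M. poly (g y) X)"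
        using g[OF z] by simp
    qed
    also have "\<dots> = poly h X * (poly (pderiv h) X / poly h X) * (\<Prod>y\<in>M. poly (g y) X)"
      using log[OF h g] by (simp add: sum_distrib_right)
    also have "\<dots> = poly ?L X" using h by (simp add: poly_prod)
    finally show ?thesis by (simp add: poly_diff)
  qed (simp add: poly_diff)
  then have "(?L - ?R) * (h * (\<Prod>z\<in>M. g z)) = 0" using poly_all_0_iff_0 by blast
  moreover have "h * (\<Prod>z\<in>M. g z) \<noteq> 0" using nz fin by simp
  ultimately show ?thesis by simp
qed

text \<open>
  For the binary form $f=\prod_i(v_iX-u_iZ)$ this is the form $\prod_{a\in S}f(X,\zeta^aZ)$
  at $Z=1$. Replacing $u$ by $zu$ rotates all of its roots by $z$.
\<close>
definition mask_form ::
  "'k::field \<Rightarrow> nat set \<Rightarrow> nat \<Rightarrow> (nat \<Rightarrow> 'k) \<Rightarrow> (nat \<Rightarrow> 'k) \<Rightarrow> 'k poly" where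
  "mask_form \<zeta> S m u v = (\<Prod>i<m. \<Prod>a\<in>S. [:- (\<zeta> ^ a * u i), v i:])"

lemma mask_form_prod_linear:
  "mask_form \<zeta> S m u v =
     (\<Prod>k\<in>{..<m} \<times> S. [:- (case k of (i, a) \<Rightarrow> \<zeta> ^ a * u i), case k of (i, a) \<Rightarrow> v i:])"
  unfolding mask_form_def prod.cartesian_product by (intro prod.cong) auto

lemma degree_mask_form:
  assumes "finite S"
  shows "Polynomial.degree (mask_form \<zeta> S m u v) \<le> m * card S"
  using degree_prod_linear[of "{..<m} \<times> S"] assms by (simp add: mask_form_prod_linear card_cartesian_product)

text \<open>
  The coefficients of a rotated mask form are those of the mask form up to powers of $z$. This makes
  the rotated forms functions of the image point alone, without reference to its preimages.
\<close>
lemma twist_mask_form: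
  assumes "finite S"
  shows "twist_form (m * card S) z (mask_form \<zeta> S m u v) = mask_form \<zeta> S m (\<lambda>i. z * u i) v"
proof -
  have "twist_form (card ({..<m} \<times> S)) z (mask_form \<zeta> S m u v) = mask_form \<zeta> S m (\<lambda>i. z * u i) v"
    unfolding mask_form_prod_linear
    by (subst twist_form_prod_linear) (use assms in \<open>auto intro!: prod.cong simp: mult_ac\<close>)
  then show ?thesis by (simp add: card_cartesian_product)
qed

lemma poly_mask_form: "poly (mask_form \<zeta> S m u v) X = (\<Prod>i<m. \<Prod>a\<in>S. v i * X - \<zeta> ^ a * u i)"
  by (simp add: mask_form_def poly_prod mult.commute)

lemma log_derivative_mask_form:
  assumes "finite S" "poly (mask_form \<zeta> S m u v) X \<noteq> 0"
  shows "poly (pderiv (mask_form \<zeta> S m u v)) X / poly (mask_form \<zeta> S m u v) X =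
    (\<Sum>i<m. \<Sum>a\<in>S. v i / (v i * X - \<zeta> ^ a * u i))"
proof -
  have "v i * X - \<zeta> ^ a * u i \<noteq> 0" if "i < m" "a \<in> S" for i a
    using assms that by (auto simp: poly_mask_form)
  then have "poly (pderiv (mask_form \<zeta> S m u v)) X = poly (mask_form \<zeta> S m u v) X *
      (\<Sum>k\<in>{..<m} \<times> S. (case k of (i, a) \<Rightarrow> v i) /
         ((case k of (i, a) \<Rightarrow> v i) * X - (case k of (i, a) \<Rightarrow> \<zeta> ^ a * u i)))"
    unfolding mask_form_prod_linear
    by (intro poly_pderiv_prod_linear) (use assms(1) in auto)
  also have "(\<Sum>k\<in>{..<m} \<times> S. (case k of (i, a) \<Rightarrow> v i) /
         ((case k of (i, a) \<Rightarrow> v i) * X - (case k of (i, a) \<Rightarrow> \<zeta> ^ a * u i))) =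
      (\<Sum>i<m. \<Sum>a\<in>S. v i / (v i * X - \<zeta> ^ a * u i))"
    unfolding sum.cartesian_product by (intro sum.cong) auto
  finally show ?thesis using assms(2) by simp
qed

lemma mask_form_nonzero:
  fixes u v :: "nat \<Rightarrow> 'k::field"
  assumes "finite S" "\<zeta> \<noteq> 0" "\<And>i. i < m \<Longrightarrow> u i \<noteq> 0 \<or> v i \<noteq> 0"
  shows "mask_form \<zeta> S m u v \<noteq> 0"
  using assms by (auto simp: mask_form_def)

text \<open>
  Each root $u_i/v_i$ contributes $W(\zeta^a)$ for $a\in S$ to the logarithmic derivative of
  $\nu_S(f)$, where $W(w)=v_i/(v_iX-wu_i)$. The convolution kernel therefore turns the rotated
  logarithmic derivatives of $\nu_S(f)$ into that of $\nu_T(f)$.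
\<close>
lemma log_derivative_mask_transfer:
  fixes \<zeta> :: "'k::field_char_0"
  assumes fin: "finite S" "finite T"
    and c: "\<And>W :: 'k \<Rightarrow> 'k. (\<Sum>z | z ^ d = 1. c z * (\<Sum>a\<in>S. W (\<zeta> ^ a * z))) = (\<Sum>t\<in>T. W (\<zeta> ^ t))"
    and nz: "poly (mask_form \<zeta> T m u v) X \<noteq> 0"
      "\<And>z. z ^ d = 1 \<Longrightarrow> poly (mask_form \<zeta> S m (\<lambda>i. z * u i) v) X \<noteq> 0"
  shows "poly (pderiv (mask_form \<zeta> T m u v)) X / poly (mask_form \<zeta> T m u v) X =
    (\<Sum>z | z ^ d = 1. c z * (poly (pderiv (mask_form \<zeta> S m (\<lambda>i. z * u i) v)) X /
       poly (mask_form \<zeta> S m (\<lambda>i. z * u i) v) X))"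
proof -
  have "(\<Sum>z | z ^ d = 1. c z * (poly (pderiv (mask_form \<zeta> S m (\<lambda>i. z * u i) v)) X /
       poly (mask_form \<zeta> S m (\<lambda>i. z * u i) v) X)) =
      (\<Sum>z | z ^ d = 1. \<Sum>i<m. c z * (\<Sum>a\<in>S. v i / (v i * X - (\<zeta> ^ a * z) * u i)))"
    by (intro sum.cong refl) (simp add: log_derivative_mask_form fin nz sum_distrib_left mult.assoc)
  also have "\<dots> = (\<Sum>i<m. \<Sum>t\<in>T. v i / (v i * X - \<zeta> ^ t * u i))"
    by (subst sum.swap) (simp only: c[of "\<lambda>w. v _ / (v _ * X - w * u _)"])
  finally show ?thesis using log_derivative_mask_form[OF fin(2) nz(1)] by simp
qed

lemma pcompose_as_sum:
  fixes f q :: "'k::field poly"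
  assumes "Polynomial.degree f \<le> n"
  shows "pcompose f q = (\<Sum>k\<le>n. Polynomial.smult (poly.coeff f k) (q ^ k))"
proof -
  have monom: "pcompose (Polynomial.monom a k) q = Polynomial.smult a (q ^ k)" for a k
    by (induction k) (simp_all add: monom_0 monom_Suc pcompose_pCons)
  show ?thesis
    by (subst poly_as_sum_of_monoms'[OF assms, symmetric]) (simp add: pcompose_sum monom)
qed

section \<open>Local polynomial formulas between mask varieties\<close>

lemma mask_map_mask_form:
  assumes "\<And>i. i < m \<Longrightarrow> u i \<noteq> 0 \<or> v i \<noteq> 0"
  shows "mask_map \<zeta> S m (form_point (\<Prod>i<m. [:- u i, v i:])) = form_point (mask_form \<zeta> S m u v)"
  unfolding mask_form_def using assms by (rule mask_map_linear_product)

lemma form_point_in_proj_space: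
  assumes "f \<noteq> 0" "Polynomial.degree f \<le> n"
  shows "form_point f \<in> proj_space n"
proof -
  have "\<exists>i. poly.coeff f i \<noteq> 0" using assms(1) by (auto simp: poly_eq_iff)
  moreover have "\<forall>i>n. poly.coeff f i = 0" using assms(2) by (auto intro: coeff_eq_0)
  ultimately show ?thesis unfolding form_point_def proj_space_def by blast
qed

lemma smult_sum_right:
  "Polynomial.smult c (\<Sum>i\<in>I. f i) = (\<Sum>i\<in>I. Polynomial.smult c (f i))"
  by (induction I rule: infinite_finite_induct) (simp_all add: smult_add_right)

text \<open>
  Write $g_z$ for the rotation of $g=\nu_S(f)$ by $z$ and $h=\nu_T(f)$. The equation
  $h'/h=\sum_zc_z\,g_z'/g_z$ becomes $h'P=hQ$ with $P=\prod_zg_z$, and the coefficients of $P$ and $Q$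
  are homogeneous in those of $g$. Expanding at a point $\xi$ where $P$ does not vanish, the recursion
  determines $h$ up to a scalar from the coefficients of $g$. Here $D$ is $P(\xi)$, and the $F_i$ are
  multiples of the coefficients of $h$.
\<close>
lemma mask_map_local_formula:
  fixes \<zeta> :: "'k :: field_char_0"
  assumes d: "d > 0" and \<zeta>: "\<zeta> ^ d = 1" and fin: "finite S" "finite T" and S: "S \<noteq> {}"
    and ZST: "mask_zeros d \<zeta> S \<subseteq> mask_zeros d \<zeta> T"
  shows "\<exists>D e\<^sub>D e F. homogeneous_fun (m * card S) e\<^sub>D D \<and>
    (\<forall>i. homogeneous_fun (m * card S) e (F i)) \<and>
    (\<forall>u v b x. (\<forall>i<m. u i \<noteq> 0 \<or> v i \<noteq> 0) \<longrightarrow> b \<noteq> 0 \<longrightarrow>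
      x = poly.coeff (Polynomial.smult b (mask_form \<zeta> S m u v)) \<longrightarrow>
      (D x = 0 \<longleftrightarrow> (\<exists>z. z ^ d = 1 \<and> poly (mask_form \<zeta> S m (\<lambda>i. z * u i) v) \<xi> = 0)) \<and>
      (D x \<noteq> 0 \<longrightarrow> (\<exists>c. c \<noteq> 0 \<and> (\<forall>i. F i x = c * poly.coeff (mask_form \<zeta> T m u v) i))))"
proof -
  let ?\<mu> = "{z :: 'k. z ^ d = 1}"
  let ?n = "m * card S" and ?n' = "m * card T" and ?e = "card ?\<mu>"
  have fin\<mu>: "finite ?\<mu>" using d by (rule finite_roots_of_unity)
  have \<zeta>nz: "\<zeta> \<noteq> 0" using \<zeta> d by (auto simp: power_0_left)
  have \<zeta>a: "(\<zeta> ^ a) ^ d = 1" for a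
    by (metis \<zeta> mult.commute power_mult power_one)
  obtain c where c: "\<And>W :: 'k \<Rightarrow> 'k.
      (\<Sum>z | z ^ d = 1. c z * (\<Sum>a\<in>S. W (\<zeta> ^ a * z))) = (\<Sum>t\<in>T. W (\<zeta> ^ t))"
    using mask_transfer_kernel[OF d \<zeta> ZST] by blast
  \<comment> \<open>The rotation by $z$ of the form with coefficients $x$, in the variable $t=X-\<xi>$.\<close>
  define G where "G z x = (\<Sum>k\<le>?n. Polynomial.smult (x k) (Polynomial.smult (z ^ (?n - k)) ([:\<xi>, 1:] ^ k)))"
    for z :: 'k and x
  define P where "P x = (\<Prod>z\<in>?\<mu>. G z x)" for x
  define Q where "Q x = (\<Sum>z\<in>?\<mu>. Polynomial.smult (c z) (pderiv (G z x) * (\<Prod>y\<in>?\<mu> - {z}. G y x)))" for x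
  have G: "homogeneous_poly_family ?n 1 (G z)" for z
    unfolding G_def by (rule homogeneous_poly_family_linear)
  have P: "homogeneous_poly_family ?n ?e P"
    using homogeneous_poly_family_prod[OF fin\<mu> G] unfolding P_def by simp
  have "homogeneous_poly_family ?n ?e (\<lambda>x. pderiv (G z x) * (\<Prod>y\<in>?\<mu> - {z}. G y x))" if "z \<in> ?\<mu>" for z
  proof -
    have card: "1 + 1 * card (?\<mu> - {z}) = ?e" using card_Suc_Diff1[OF fin\<mu> that] by simp
    have "homogeneous_poly_family ?n (1 * card (?\<mu> - {z})) (\<lambda>x. \<Prod>y\<in>?\<mu> - {z}. G y x)"
      by (rule homogeneous_poly_family_prod) (use fin\<mu> G in auto)
    from homogeneous_poly_family_mult[OF homogeneous_poly_family_pderiv[OF G, of z] this]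
    show ?thesis unfolding card .
  qed
  then have Q: "homogeneous_poly_family ?n ?e Q"
    unfolding Q_def by (intro homogeneous_poly_family_sum homogeneous_poly_family_smult)
  obtain H where H: "\<And>k. homogeneous_fun ?n (?e * k) (H k)"
    and rec: "\<And>k x h. pderiv h * P x = h * Q x \<Longrightarrow>
       poly.coeff h k * poly.coeff (P x) 0 ^ k = poly.coeff h 0 * H k x"
    using first_order_ode_coeffs[OF P Q] by metis
  define D where "D x = poly.coeff (P x) 0" for x
  \<comment> \<open>Undo the shift by $\<xi>$; the power of $D$ makes all summands homogeneous of the same degree.\<close>
  define F where "F i x = (\<Sum>k\<le>?n'. poly.coeff ([:- \<xi>, 1:] ^ k) i * (H k x * D x ^ (?n' - k)))" for i x
  have D: "homogeneous_fun ?n ?e D"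
    using P unfolding homogeneous_poly_family_def D_def by blast
  have "homogeneous_fun ?n (?e * ?n') (\<lambda>x. H k x * D x ^ (?n' - k))" if "k \<le> ?n'" for k
  proof -
    have "?e * ?n' = ?e * k + ?e * (?n' - k)" using that by (simp flip: distrib_left)
    then show ?thesis
      using homogeneous_fun_mult[OF H homogeneous_fun_power[OF D, of "?n' - k"], of k] by (simp only:)
  qed
  then have F: "homogeneous_fun ?n (?e * ?n') (F i)" for i
    unfolding F_def by (intro homogeneous_fun_sum homogeneous_fun_cmult) auto
  have main: "(D x = 0 \<longleftrightarrow> (\<exists>z. z ^ d = 1 \<and> poly (mask_form \<zeta> S m (\<lambda>i. z * u i) v) \<xi> = 0)) \<and>
      (D x \<noteq> 0 \<longrightarrow> (\<exists>c. c \<noteq> 0 \<and> (\<forall>i. F i x = c * poly.coeff (mask_form \<zeta> T m u v) i)))"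
    if uv: "\<forall>i<m. u i \<noteq> 0 \<or> v i \<noteq> 0" and b: "b \<noteq> 0"
      and x: "x = poly.coeff (Polynomial.smult b (mask_form \<zeta> S m u v))" for u v b x
  proof -
    define g where "g z = mask_form \<zeta> S m (\<lambda>i. z * u i) v" for z
    define h where "h = mask_form \<zeta> T m u v"
    define h\<xi> where "h\<xi> = pcompose h [:\<xi>, 1:]"
    have Gx: "G z x = Polynomial.smult b (pcompose (g z) [:\<xi>, 1:])" for z
    proof -
      have "poly.coeff (g z) k = z ^ (?n - k) * poly.coeff (mask_form \<zeta> S m u v) k" if "k \<le> ?n" for k
        using that unfolding g_def twist_mask_form[OF fin(1), symmetric] by (simp add: coeff_twist_form)
      moreover have "Polynomial.degree (g z) \<le> ?n" unfolding g_def by (rule degree_mask_form[OF fin(1)])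
      ultimately show ?thesis
        unfolding G_def x pcompose_as_sum[OF \<open>Polynomial.degree (g z) \<le> ?n\<close>] smult_sum_right
        by (intro sum.cong refl) (simp add: mult_ac)
    qed
    have Dx: "D x = (\<Prod>z\<in>?\<mu>. b * poly (g z) \<xi>)"
    proof -
      have "D x = poly (P x) 0" by (simp add: D_def poly_0_coeff_0)
      then show ?thesis by (simp add: P_def Gx poly_prod poly_pcompose)
    qed
    have zero: "D x = 0 \<longleftrightarrow> (\<exists>z. z ^ d = 1 \<and> poly (g z) \<xi> = 0)"
      using fin\<mu> b by (auto simp: Dx)
    have "h \<noteq> 0" unfolding h_def using mask_form_nonzero[OF fin(2) \<zeta>nz] uv by blast
    then have h\<xi>_nz: "h\<xi> \<noteq> 0" unfolding h\<xi>_def by (simp add: pcompose_eq_0_iff)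
    have g_nz: "g z \<noteq> 0" if "z \<in> ?\<mu>" for z
    proof -
      have "z \<noteq> 0" using that d by (auto simp: power_0_left)
      then show ?thesis unfolding g_def using mask_form_nonzero[OF fin(1) \<zeta>nz] uv by auto
    qed
    have ode: "pderiv h\<xi> * P x = h\<xi> * Q x"
      unfolding P_def Q_def
    proof (rule log_derivative_clear_denominators[OF fin\<mu> h\<xi>_nz])
      show "G z x \<noteq> 0" if "z \<in> ?\<mu>" for z
        using b g_nz[OF that] by (simp add: Gx pcompose_eq_0_iff)
    next
      fix X assume "poly h\<xi> X \<noteq> 0" and g: "\<And>z. z \<in> ?\<mu> \<Longrightarrow> poly (G z x) X \<noteq> 0"
      then have h: "poly h (\<xi> + X) \<noteq> 0" by (simp add: h\<xi>_def poly_pcompose)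
      have "poly (pderiv h) (\<xi> + X) / poly h (\<xi> + X) =
          (\<Sum>z\<in>?\<mu>. c z * (poly (pderiv (g z)) (\<xi> + X) / poly (g z) (\<xi> + X)))"
        using h g unfolding h_def g_def
        by (intro log_derivative_mask_transfer[OF fin c]) (auto simp: Gx g_def poly_pcompose)
      then show "poly (pderiv h\<xi>) X / poly h\<xi> X =
          (\<Sum>z\<in>?\<mu>. c z * (poly (pderiv (G z x)) X / poly (G z x) X))"
        using b by (simp add: h\<xi>_def Gx pderiv_smult pderiv_pcompose pderiv_pCons poly_pcompose)
    qed
    have "\<exists>c. c \<noteq> 0 \<and> (\<forall>i. F i x = c * poly.coeff h i)" if nz: "D x \<noteq> 0"
    proof -
      obtain a where a: "a \<in> S" using S by blast
      have "poly h \<xi> \<noteq> 0"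
      proof
        assume "poly h \<xi> = 0"
        then obtain i t where it: "i < m" "t \<in> T" "v i * \<xi> = \<zeta> ^ t * u i"
          using fin(2) by (auto simp: h_def poly_mask_form)
        \<comment> \<open>A zero of $h$ is a zero of a rotation of $g$, by $\<zeta>^{t-a}$ for any $a\<in>S$.\<close>
        have "(\<zeta> ^ t / \<zeta> ^ a) ^ d = 1" by (simp add: power_divide \<zeta>a)
        moreover have "v i * \<xi> - \<zeta> ^ a * (\<zeta> ^ t / \<zeta> ^ a * u i) = 0" using it(3) \<zeta>nz by simp
        then have "poly (g (\<zeta> ^ t / \<zeta> ^ a)) \<xi> = 0"
          unfolding g_def poly_mask_form using it(1) a fin(1)
          by (intro prod_zero bexI[of _ i] bexI[of _ a]) auto
        ultimately show False using zero nz by blast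
      qed
      then have h0: "poly.coeff h\<xi> 0 \<noteq> 0"
        by (simp add: h\<xi>_def poly_pcompose flip: poly_0_coeff_0)
      have deg: "Polynomial.degree h\<xi> \<le> ?n'"
        using degree_mask_form[OF fin(2), of \<zeta> m u v] by (simp add: h\<xi>_def h_def degree_pcompose)
      have unshift: "pcompose h\<xi> [:- \<xi>, 1:] = h"
        by (simp add: h\<xi>_def pcompose_pCons flip: pcompose_assoc)
      have h_sum: "h = (\<Sum>k\<le>?n'. Polynomial.smult (poly.coeff h\<xi> k) ([:- \<xi>, 1:] ^ k))"
        using pcompose_as_sum[OF deg, of "[:- \<xi>, 1:]"] unfolding unshift .
      have "poly.coeff h\<xi> 0 * F i x = D x ^ ?n' * poly.coeff h i" for i
      proof -
        have "poly.coeff h\<xi> 0 * (H k x * D x ^ (?n' - k)) = D x ^ ?n' * poly.coeff h\<xi> k" if "k \<le> ?n'" for k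
        proof -
          have "poly.coeff h\<xi> 0 * (H k x * D x ^ (?n' - k)) =
              poly.coeff h\<xi> k * (D x ^ k * D x ^ (?n' - k))"
            using rec[OF ode, of k] by (simp add: D_def)
          then show ?thesis using that by (simp flip: power_add)
        qed
        then have "poly.coeff h\<xi> 0 * F i x =
            (\<Sum>k\<le>?n'. poly.coeff ([:- \<xi>, 1:] ^ k) i * (D x ^ ?n' * poly.coeff h\<xi> k))"
          unfolding F_def sum_distrib_left by (intro sum.cong refl) (simp add: mult.left_commute)
        also have "\<dots> = D x ^ ?n' * poly.coeff h i"
          by (subst h_sum) (simp add: coeff_sum sum_distrib_left mult_ac)
        finally show ?thesis .
      qed
      then have "F i x = (D x ^ ?n' / poly.coeff h\<xi> 0) * poly.coeff h i" for i
        using h0 by (simp add: field_simps)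
      moreover have "D x ^ ?n' / poly.coeff h\<xi> 0 \<noteq> 0" using nz h0 by simp
      ultimately show ?thesis by blast
    qed
    then show ?thesis using zero by (simp add: g_def h_def)
  qed
  show ?thesis
    by (rule exI[of _ D], rule exI[of _ ?e], rule exI[of _ "?e * ?n'"], rule exI[of _ F],
        intro conjI[OF D] conjI[OF allI[OF F]] allI impI main) blast
qed

lemma mask_map_in_proj_space:
  fixes \<zeta> :: "'k :: alg_closed_field"
  assumes "finite S" "\<zeta> \<noteq> 0" "p \<in> proj_space m"
  shows "mask_map \<zeta> S m p \<in> proj_space (m * card S)"
proof -
  obtain u v where p: "p = form_point (\<Prod>i<m. [:- u i, v i:])" and uv: "\<forall>i<m. u i \<noteq> 0 \<or> v i \<noteq> 0"
    using assms(3) unfolding proj_space_eq_linear_products by blast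
  have "mask_form \<zeta> S m u v \<noteq> 0" using mask_form_nonzero[OF assms(1,2)] uv by blast
  then have "form_point (mask_form \<zeta> S m u v) \<in> proj_space (m * card S)"
    using degree_mask_form[OF assms(1)] by (rule form_point_in_proj_space)
  then show ?thesis unfolding p using uv by (simp add: mask_map_mask_form)
qed

text \<open>
  A suitable $\xi$ exists near every point, and the formula holds for every homogeneous coordinate
  vector of the image point.
\<close>
lemma mask_map_factors_locally:
  fixes \<zeta> :: "'k :: {alg_closed_field, field_char_0}"
  assumes d: "d > 0" and \<zeta>: "\<zeta> ^ d = 1" and fin: "finite S" "finite T" and S: "S \<noteq> {}"
    and ZST: "mask_zeros d \<zeta> S \<subseteq> mask_zeros d \<zeta> T" and p0: "p0 \<in> proj_space m"
  shows "\<exists>D e\<^sub>D e F. homogeneous_fun (m * card S) e\<^sub>D D \<and>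
    (\<forall>i. homogeneous_fun (m * card S) e (F i)) \<and>
    (\<forall>x\<in>mask_map \<zeta> S m p0. D x \<noteq> 0) \<and>
    (\<forall>p\<in>proj_space m. \<forall>x\<in>mask_map \<zeta> S m p. D x \<noteq> 0 \<longrightarrow>
      (\<exists>i\<le>m * card T. F i x \<noteq> 0) \<and>
      mask_map \<zeta> T m p = proj_point (\<lambda>i. if i \<le> m * card T then F i x else 0))"
proof -
  have \<zeta>nz: "\<zeta> \<noteq> 0" using \<zeta> d by (auto simp: power_0_left)
  have member: "\<exists>u v b. (\<forall>i<m. u i \<noteq> 0 \<or> v i \<noteq> 0) \<and> b \<noteq> 0 \<and>
      x = poly.coeff (Polynomial.smult b (mask_form \<zeta> S m u v)) \<and>
      mask_map \<zeta> T m p = form_point (mask_form \<zeta> T m u v)"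
    if mem: "p \<in> proj_space m" "x \<in> mask_map \<zeta> S m p" for p x
  proof -
    obtain u v where p: "p = form_point (\<Prod>i<m. [:- u i, v i:])" and uv: "\<forall>i<m. u i \<noteq> 0 \<or> v i \<noteq> 0"
      using mem(1) unfolding proj_space_eq_linear_products by blast
    have "x \<in> form_point (mask_form \<zeta> S m u v)" using mem(2) uv unfolding p by (simp add: mask_map_mask_form)
    then obtain b where "b \<noteq> 0" "x = (\<lambda>i. b * poly.coeff (mask_form \<zeta> S m u v) i)"
      unfolding form_point_def proj_point_def by blast
    moreover have "mask_map \<zeta> T m p = form_point (mask_form \<zeta> T m u v)"
      unfolding p using uv by (simp add: mask_map_mask_form)
    ultimately show ?thesis using uv by (intro exI[of _ u] exI[of _ v] exI[of _ b]) (auto simp: fun_eq_iff)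
  qed
  obtain u v where p0_eq: "p0 = form_point (\<Prod>i<m. [:- u i, v i:])" and uv: "\<forall>i<m. u i \<noteq> 0 \<or> v i \<noteq> 0"
    using p0 unfolding proj_space_eq_linear_products by blast
  let ?N = "\<Prod>z | z ^ d = 1. mask_form \<zeta> S m (\<lambda>i. z * u i) v"
  have fin\<mu>: "finite {z :: 'k. z ^ d = 1}" using d by (rule finite_roots_of_unity)
  have "mask_form \<zeta> S m (\<lambda>i. z * u i) v \<noteq> 0" if "z ^ d = 1" for z
  proof -
    have "z \<noteq> 0" using that d by (auto simp: power_0_left)
    then show ?thesis using mask_form_nonzero[OF fin(1) \<zeta>nz] uv by auto
  qed
  then have "?N \<noteq> 0" using fin\<mu> by simp
  \<comment> \<open>A centre of expansion that avoids the finitely many zeros of all rotations.\<close>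
  then obtain \<xi> where "poly ?N \<xi> \<noteq> 0" using poly_all_0_iff_0 by blast
  then have \<xi>: "\<And>z. z ^ d = 1 \<Longrightarrow> poly (mask_form \<zeta> S m (\<lambda>i. z * u i) v) \<xi> \<noteq> 0"
    using fin\<mu> by (auto simp: poly_prod)
  obtain D e\<^sub>D e F where D: "homogeneous_fun (m * card S) e\<^sub>D D"
    and F: "\<forall>i. homogeneous_fun (m * card S) e (F i)"
    and DF: "\<forall>u v b x. (\<forall>i<m. u i \<noteq> 0 \<or> v i \<noteq> 0) \<longrightarrow> b \<noteq> 0 \<longrightarrow>
      x = poly.coeff (Polynomial.smult b (mask_form \<zeta> S m u v)) \<longrightarrow>
      (D x = 0 \<longleftrightarrow> (\<exists>z. z ^ d = 1 \<and> poly (mask_form \<zeta> S m (\<lambda>i. z * u i) v) \<xi> = 0)) \<and>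
      (D x \<noteq> 0 \<longrightarrow> (\<exists>c. c \<noteq> 0 \<and> (\<forall>i. F i x = c * poly.coeff (mask_form \<zeta> T m u v) i)))"
    using mask_map_local_formula[OF d \<zeta> fin S ZST, of m \<xi>] by (elim exE conjE) (rule that; assumption)
  note zero = DF[rule_format, THEN conjunct1] and val = DF[rule_format, THEN conjunct2, rule_format]
  have "D x \<noteq> 0" if "x \<in> mask_map \<zeta> S m p0" for x
  proof -
    have "x \<in> form_point (mask_form \<zeta> S m u v)"
      using that uv unfolding p0_eq by (simp add: mask_map_mask_form)
    then obtain b where "b \<noteq> 0" "x = (\<lambda>i. b * poly.coeff (mask_form \<zeta> S m u v) i)"
      unfolding form_point_def proj_point_def by blast
    then have b: "b \<noteq> 0" and x: "x = poly.coeff (Polynomial.smult b (mask_form \<zeta> S m u v))" by auto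
    show ?thesis using zero[OF _ b x] uv \<xi> by blast
  qed
  then have D0: "\<forall>x\<in>mask_map \<zeta> S m p0. D x \<noteq> 0" by blast
  have vals: "\<forall>p\<in>proj_space m. \<forall>x\<in>mask_map \<zeta> S m p. D x \<noteq> 0 \<longrightarrow>
      (\<exists>i\<le>m * card T. F i x \<noteq> 0) \<and>
      mask_map \<zeta> T m p = proj_point (\<lambda>i. if i \<le> m * card T then F i x else 0)"
  proof (intro ballI impI)
    fix p x assume px: "p \<in> proj_space m" "x \<in> mask_map \<zeta> S m p" and nz: "D x \<noteq> 0"
    obtain u v b where uv: "\<forall>i<m. u i \<noteq> 0 \<or> v i \<noteq> 0" and b: "b \<noteq> 0"
      and x: "x = poly.coeff (Polynomial.smult b (mask_form \<zeta> S m u v))"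
      and T: "mask_map \<zeta> T m p = form_point (mask_form \<zeta> T m u v)"
      using member[OF px] by blast
    let ?h = "mask_form \<zeta> T m u v"
    obtain c where c: "c \<noteq> 0" "\<And>i. F i x = c * poly.coeff ?h i"
      using val[OF _ b x nz] uv by blast
    have high: "poly.coeff ?h i = 0" if "i > m * card T" for i
      using degree_mask_form[OF fin(2), of \<zeta> m u v] that by (intro coeff_eq_0) auto
    have "?h \<noteq> 0" using mask_form_nonzero[OF fin(2) \<zeta>nz] uv by blast
    then obtain i where i: "poly.coeff ?h i \<noteq> 0" by (auto simp: poly_eq_iff)
    then have "i \<le> m * card T" using high not_le by blast
    then have "\<exists>i\<le>m * card T. F i x \<noteq> 0" using i c by auto
    moreover have "(\<lambda>i. if i \<le> m * card T then F i x else 0) = (\<lambda>i. c * poly.coeff ?h i)"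
      using c(2) high by (auto simp: fun_eq_iff)
    ultimately show "(\<exists>i\<le>m * card T. F i x \<noteq> 0) \<and>
      mask_map \<zeta> T m p = proj_point (\<lambda>i. if i \<le> m * card T then F i x else 0)"
      using c(1) by (simp add: T form_point_def proj_point_scale)
  qed
  show ?thesis
    by (rule exI[of _ D], rule exI[of _ e\<^sub>D], rule exI[of _ e], rule exI[of _ F])
      (intro conjI D F D0 vals)
qed

text \<open>
  The local formulas involve only the image point under $\nu_S$. Hence they show at once that
  $\nu_T$ is constant on the fibres of $\nu_S$ and that the induced map is a morphism.
\<close>
lemma mask_transfer_morphism:
  fixes \<zeta> :: "'k :: {alg_closed_field, field_char_0}"
  assumes d: "d > 0" and \<zeta>: "\<zeta> ^ d = 1" and fin: "finite S" "finite T" and S: "S \<noteq> {}"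
    and ZST: "mask_zeros d \<zeta> S \<subseteq> mask_zeros d \<zeta> T"
  shows "\<exists>\<phi>. variety_morphism (m * card S) (mask_variety \<zeta> S m) (m * card T) (mask_variety \<zeta> T m) \<phi> \<and>
    (\<forall>p\<in>proj_space m. \<phi> (mask_map \<zeta> S m p) = mask_map \<zeta> T m p)"
proof -
  let ?Y = "mask_variety \<zeta> S m" and ?n = "m * card S" and ?n' = "m * card T"
  have \<zeta>nz: "\<zeta> \<noteq> 0" using \<zeta> d by (auto simp: power_0_left)
  note local = mask_map_factors_locally[OF d \<zeta> fin S ZST, of _ m]
  have nonempty: "\<exists>x. x \<in> mask_map \<zeta> S m p" if "p \<in> proj_space m" for p
    using mask_map_in_proj_space[OF fin(1) \<zeta>nz that] proj_point_self unfolding proj_space_def by blast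
  have factor: "mask_map \<zeta> T m p = mask_map \<zeta> T m p'"
    if p: "p \<in> proj_space m" "p' \<in> proj_space m" and eq: "mask_map \<zeta> S m p = mask_map \<zeta> S m p'" for p p'
  proof -
    obtain x where x: "x \<in> mask_map \<zeta> S m p" using nonempty[OF p(1)] by blast
    obtain D e\<^sub>D e F where "homogeneous_fun ?n e\<^sub>D D" "\<forall>i. homogeneous_fun ?n e (F i)"
      and D: "\<forall>x\<in>mask_map \<zeta> S m p. D x \<noteq> 0"
      and val: "\<forall>p\<in>proj_space m. \<forall>x\<in>mask_map \<zeta> S m p. D x \<noteq> 0 \<longrightarrow>
        (\<exists>i\<le>?n'. F i x \<noteq> 0) \<and>
        mask_map \<zeta> T m p = proj_point (\<lambda>i. if i \<le> ?n' then F i x else 0)"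
      using local[OF p(1)] by (elim exE conjE) (rule that; assumption)
    have "D x \<noteq> 0" using D x by blast
    moreover have "x \<in> mask_map \<zeta> S m p'" using x eq by simp
    ultimately show ?thesis
      using val[rule_format, OF p(1) x] val[rule_format, OF p(2), of x] by simp
  qed
  define \<phi> where "\<phi> = restrict (\<lambda>q. mask_map \<zeta> T m (SOME p. p \<in> proj_space m \<and> mask_map \<zeta> S m p = q)) ?Y"
  have \<phi>: "\<phi> (mask_map \<zeta> S m p) = mask_map \<zeta> T m p" if p: "p \<in> proj_space m" for p
  proof -
    let ?p' = "SOME p'. p' \<in> proj_space m \<and> mask_map \<zeta> S m p' = mask_map \<zeta> S m p"
    have "?p' \<in> proj_space m \<and> mask_map \<zeta> S m ?p' = mask_map \<zeta> S m p"
      by (rule someI[of _ p]) (use p in simp)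
    then have "mask_map \<zeta> T m ?p' = mask_map \<zeta> T m p" using factor p by blast
    then show ?thesis using p by (simp add: \<phi>_def mask_variety_def)
  qed
  have "\<phi> \<in> ?Y \<rightarrow>\<^sub>E mask_variety \<zeta> T m"
  proof (rule PiE_I)
    show "\<phi> q \<in> mask_variety \<zeta> T m" if "q \<in> ?Y" for q
      using that \<phi> unfolding mask_variety_def by auto
    show "\<phi> q = undefined" if "q \<notin> ?Y" for q using that by (simp add: \<phi>_def)
  qed
  moreover have "\<exists>U e F. zariski_open_in ?n ?Y U \<and> q0 \<in> U \<and>
      (\<forall>i\<le>?n'. homogeneous_poly ?n e (F i)) \<and>
      (\<forall>q\<in>U. \<forall>x\<in>q. (\<exists>i\<le>?n'. mvpoly_eval (F i) x \<noteq> 0) \<and>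
         \<phi> q = proj_point (\<lambda>i. if i \<le> ?n' then mvpoly_eval (F i) x else 0))"
    if q0: "q0 \<in> ?Y" for q0
  proof -
    obtain p0 where p0: "p0 \<in> proj_space m" "q0 = mask_map \<zeta> S m p0"
      using q0 unfolding mask_variety_def by blast
    obtain D e\<^sub>D e F where D: "homogeneous_fun ?n e\<^sub>D D"
      and F: "\<forall>i. homogeneous_fun ?n e (F i)"
      and D0: "\<forall>x\<in>mask_map \<zeta> S m p0. D x \<noteq> 0"
      and val: "\<forall>p\<in>proj_space m. \<forall>x\<in>mask_map \<zeta> S m p. D x \<noteq> 0 \<longrightarrow>
        (\<exists>i\<le>?n'. F i x \<noteq> 0) \<and>
        mask_map \<zeta> T m p = proj_point (\<lambda>i. if i \<le> ?n' then F i x else 0)"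
      using local[OF p0(1)] by (elim exE conjE) (rule that; assumption)
    obtain D' where D': "homogeneous_poly ?n e\<^sub>D D'" "\<And>x. mvpoly_eval D' x = D x"
      using D unfolding homogeneous_fun_def by blast
    obtain F' where F': "\<And>i. homogeneous_poly ?n e (F' i)" "\<And>i x. mvpoly_eval (F' i) x = F i x"
      using F unfolding homogeneous_fun_def by metis
    define U where "U = ?Y - proj_zeros ?n {D'}"
    have opn: "zariski_open_in ?n ?Y U"
      unfolding zariski_open_in_def zariski_closed_def U_def
      by (intro exI[of _ "proj_zeros ?n {D'}"] conjI exI[of _ "{D'}"]) (use D'(1) in auto)
    have q0U: "q0 \<in> U"
      using q0 D0 nonempty[OF p0(1)] unfolding U_def proj_zeros_def p0(2) by (auto simp: D'(2))
    have vals: "(\<exists>i\<le>?n'. F i x \<noteq> 0) \<and> \<phi> q = proj_point (\<lambda>i. if i \<le> ?n' then F i x else 0)"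
      if q: "q \<in> U" and x: "x \<in> q" for q x
    proof -
      obtain p where p: "p \<in> proj_space m" "q = mask_map \<zeta> S m p"
        using q unfolding U_def mask_variety_def by blast
      have qs: "q \<in> proj_space ?n"
        unfolding p(2) by (rule mask_map_in_proj_space[OF fin(1) \<zeta>nz p(1)])
      then obtain y where y: "y \<in> q" "D y \<noteq> 0"
        using q unfolding U_def proj_zeros_def by (auto simp: D'(2))
      obtain w where w: "q = proj_point w" using qs unfolding proj_space_def by blast
      obtain a where a: "a \<noteq> 0" "x = (\<lambda>i. a * w i)" using x unfolding w proj_point_def by blast
      obtain b where b: "b \<noteq> 0" "y = (\<lambda>i. b * w i)" using y(1) unfolding w proj_point_def by blast
      have "D x \<noteq> 0"
        using y(2) a(1) unfolding a(2) b(2) homogeneous_fun_scale[OF D] by simp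
      then show ?thesis using val[rule_format, OF p(1), of x] x \<phi>[OF p(1)] unfolding p(2) by simp
    qed
    show ?thesis
      by (rule exI[of _ U], rule exI[of _ e], rule exI[of _ F'], unfold F'(2))
        (intro conjI[OF opn] conjI[OF q0U] conjI[OF allI[OF impI[OF F'(1)]]] ballI vals)
  qed
  ultimately have "variety_morphism ?n ?Y ?n' (mask_variety \<zeta> T m) \<phi>"
    unfolding variety_morphism_def by (intro conjI ballI)
  then show ?thesis using \<phi> by blast
qed

lemma mask_transfer_isomorphism:
  fixes \<zeta> :: "'k :: {alg_closed_field, field_char_0}"
  assumes d: "d > 0" and \<zeta>: "\<zeta> ^ d = 1" and fin: "finite S" "finite T" and ne: "S \<noteq> {}" "T \<noteq> {}"
    and ZST: "mask_zeros d \<zeta> S = mask_zeros d \<zeta> T"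
  shows "\<exists>!\<phi>. variety_isomorphism (m * card S) (mask_variety \<zeta> S m) (m * card T) (mask_variety \<zeta> T m) \<phi> \<and>
    (\<forall>p\<in>proj_space m. \<phi> (mask_map \<zeta> S m p) = mask_map \<zeta> T m p)"
proof -
  obtain \<phi> where \<phi>: "variety_morphism (m * card S) (mask_variety \<zeta> S m) (m * card T) (mask_variety \<zeta> T m) \<phi>"
    "\<And>p. p \<in> proj_space m \<Longrightarrow> \<phi> (mask_map \<zeta> S m p) = mask_map \<zeta> T m p"
    using mask_transfer_morphism[OF d \<zeta> fin ne(1) equalityD1[OF ZST], of m] by blast
  obtain \<psi> where \<psi>: "variety_morphism (m * card T) (mask_variety \<zeta> T m) (m * card S) (mask_variety \<zeta> S m) \<psi>"
    "\<And>p. p \<in> proj_space m \<Longrightarrow> \<psi> (mask_map \<zeta> T m p) = mask_map \<zeta> S m p"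
    using mask_transfer_morphism[OF d \<zeta> fin(2,1) ne(2) equalityD2[OF ZST], of m] by blast
  have inv: "\<forall>p\<in>mask_variety \<zeta> S m. \<psi> (\<phi> p) = p" "\<forall>q\<in>mask_variety \<zeta> T m. \<phi> (\<psi> q) = q"
    by (simp_all add: mask_variety_def \<phi>(2) \<psi>(2))
  have iso: "variety_isomorphism (m * card S) (mask_variety \<zeta> S m) (m * card T) (mask_variety \<zeta> T m) \<phi>"
    unfolding variety_isomorphism_def by (rule conjI[OF \<phi>(1)], rule exI[of _ \<psi>], rule conjI[OF \<psi>(1)], rule conjI[OF inv])
  have uniq: "\<phi>' = \<phi>"
    if "variety_isomorphism (m * card S) (mask_variety \<zeta> S m) (m * card T) (mask_variety \<zeta> T m) \<phi>'"
      "\<forall>p\<in>proj_space m. \<phi>' (mask_map \<zeta> S m p) = mask_map \<zeta> T m p" for \<phi>'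
  proof (rule PiE_ext)
    show "\<phi>' \<in> mask_variety \<zeta> S m \<rightarrow>\<^sub>E mask_variety \<zeta> T m"
      using that(1) unfolding variety_isomorphism_def variety_morphism_def by (elim conjE)
    show "\<phi> \<in> mask_variety \<zeta> S m \<rightarrow>\<^sub>E mask_variety \<zeta> T m"
      using \<phi>(1) unfolding variety_morphism_def by (elim conjE)
    show "\<phi>' q = \<phi> q" if "q \<in> mask_variety \<zeta> S m" for q
      using that \<open>\<forall>p\<in>proj_space m. \<phi>' (mask_map \<zeta> S m p) = mask_map \<zeta> T m p\<close> \<phi>(2)
      unfolding mask_variety_def by (elim imageE) simp
  qed
  show ?thesis
    by (rule ex1I[of _ \<phi>]) (use iso \<phi>(2) in simp, use uniq in blast)
qed

section \<open>Conjugate roots of integer polynomials\<close>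

lemma power_power_commute: "(x ^ a) ^ b = (x ^ b) ^ (a::nat)" for x :: "'a::monoid_mult"
  unfolding power_mult[symmetric] by (subst mult.commute) (rule refl)

text \<open>
  Evaluation of integer polynomials at elements of another ring; all polynomial identities used
  below for roots of unity have integer coefficients.
\<close>
definition int_poly_eval :: "int poly \<Rightarrow> 'k::comm_ring_1 \<Rightarrow> 'k" where
  "int_poly_eval f w = poly (map_poly of_int f) w"

lemma int_poly_eval_0 [simp]: "int_poly_eval 0 w = 0"
  by (simp add: int_poly_eval_def)

lemma int_poly_eval_pCons [simp]:
  "int_poly_eval (pCons a f) w = of_int a + w * int_poly_eval f w"
  by (cases "a = 0 \<and> f = 0") (auto simp: int_poly_eval_def map_poly_pCons)

lemma int_poly_eval_1 [simp]: "int_poly_eval 1 w = 1"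
  by (simp add: one_pCons)

lemma int_poly_eval_add [simp]: "int_poly_eval (f + g) w = int_poly_eval f w + int_poly_eval g w"
  by (induction f g rule: poly_induct2) (simp_all add: algebra_simps)

lemma int_poly_eval_smult [simp]: "int_poly_eval (Polynomial.smult a f) w = of_int a * int_poly_eval f w"
  by (induction f) (simp_all add: algebra_simps)

lemma int_poly_eval_diff [simp]: "int_poly_eval (f - g) w = int_poly_eval f w - int_poly_eval g w"
  using int_poly_eval_add[of "f - g" g w] by (simp del: int_poly_eval_add)

lemma int_poly_eval_mult [simp]: "int_poly_eval (f * g) w = int_poly_eval f w * int_poly_eval g w"
  by (induction f) (simp_all add: algebra_simps)

lemma int_poly_eval_power [simp]: "int_poly_eval (f ^ n) w = int_poly_eval f w ^ n"
  by (induction n) simp_all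

lemma int_poly_eval_monom [simp]: "int_poly_eval (Polynomial.monom a n) w = of_int a * w ^ n"
  by (induction n) (simp_all add: monom_0 monom_Suc mult_ac)

lemma int_poly_eval_sum [simp]: "int_poly_eval (\<Sum>i\<in>I. f i) w = (\<Sum>i\<in>I. int_poly_eval (f i) w)"
  by (induction I rule: infinite_finite_induct) simp_all

lemma int_poly_eval_pcompose: "int_poly_eval (pcompose f g) w = int_poly_eval f (int_poly_eval g w)"
  by (induction f) (simp_all add: pcompose_pCons)

text \<open>
  An annihilator of least degree divides a multiple of every other annihilator by pseudo-division;
  when it is primitive, Gauss' lemma removes the multiple.
\<close>
lemma int_annihilator_generator_exists:
  fixes w :: "'k::field_char_0"
  assumes "f0 \<noteq> 0" "int_poly_eval f0 w = 0"
  shows "\<exists>\<mu>. \<mu> \<noteq> 0 \<and> int_poly_eval \<mu> w = 0 \<and> (\<forall>f. int_poly_eval f w = 0 \<longrightarrow> \<mu> dvd f)"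
proof -
  obtain \<mu>0 where \<mu>0: "\<mu>0 \<noteq> 0" "int_poly_eval \<mu>0 w = 0"
    and min: "\<And>f. f \<noteq> 0 \<Longrightarrow> int_poly_eval f w = 0 \<Longrightarrow> Polynomial.degree \<mu>0 \<le> Polynomial.degree f"
    using ex_has_least_nat[of "\<lambda>f. f \<noteq> 0 \<and> int_poly_eval f w = 0" f0 Polynomial.degree] assms by auto
  define \<mu> where "\<mu> = primitive_part \<mu>0"
  have c: "content \<mu>0 \<noteq> 0" "\<mu>0 = Polynomial.smult (content \<mu>0) \<mu>"
    using \<mu>0(1) by (auto simp: \<mu>_def)
  have "of_int (content \<mu>0) * int_poly_eval \<mu> w = 0"
    using \<mu>0(2) by (subst (asm) c(2)) simp
  then have \<mu>w: "int_poly_eval \<mu> w = 0" using c(1) by simp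
  have \<mu>: "\<mu> \<noteq> 0" "content \<mu> = 1" "Polynomial.degree \<mu> = Polynomial.degree \<mu>0"
    using \<mu>0(1) by (auto simp: \<mu>_def)
  have "\<mu> dvd f" if f: "int_poly_eval f w = 0" for f
  proof -
    define r where "r = pseudo_mod f \<mu>"
    obtain a q where aq: "a \<noteq> 0" "Polynomial.smult a f = \<mu> * q + r"
      using pseudo_mod(1)[OF \<mu>(1), of f] unfolding r_def by blast
    have "int_poly_eval (Polynomial.smult a f) w = int_poly_eval (\<mu> * q + r) w" using aq(2) by simp
    then have "int_poly_eval r w = 0" using f \<mu>w by simp
    moreover have "r = 0 \<or> Polynomial.degree r < Polynomial.degree \<mu>0"
      using pseudo_mod(2)[OF \<mu>(1), of f] unfolding r_def \<mu>(3) .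
    ultimately have "r = 0" using min[of r] by linarith
    then have eq: "Polynomial.smult a f = \<mu> * q" using aq(2) by simp
    have "Polynomial.smult a f = [:a:] * f" by simp
    then have "[:a:] dvd Polynomial.smult a f" by (simp only: dvd_triv_left)
    then have "a dvd content (\<mu> * q)" unfolding eq const_poly_dvd_iff_dvd_content .
    then have "[:a:] dvd q" unfolding content_mult \<mu>(2) const_poly_dvd_iff_dvd_content by simp
    then obtain q' where "q = [:a:] * q'" by (rule dvdE)
    then have "Polynomial.smult a f = Polynomial.smult a (\<mu> * q')" using eq by simp
    then have "Polynomial.smult a (f - \<mu> * q') = 0" by (simp add: smult_diff_right)
    then have "f = \<mu> * q'" using aq(1) by simp
    then show ?thesis by simp
  qed
  then show ?thesis using \<mu>(1) \<mu>w by blast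
qed

lemma prime_dvd_freshmans_defect:
  fixes x y :: "'a::comm_ring_1"
  assumes "prime p"
  shows "of_nat p dvd (x + y) ^ p - (x ^ p + y ^ p)"
proof -
  have p: "p > 0" using assms prime_gt_0_nat by blast
  have "(x + y) ^ p = (\<Sum>k\<le>p. of_nat (p choose k) * x ^ k * y ^ (p - k))"
    by (rule binomial_ring)
  also have "{..p} = insert 0 (insert p {0<..<p})" using p by auto
  also have "(\<Sum>k\<in>insert 0 (insert p {0<..<p}). of_nat (p choose k) * x ^ k * y ^ (p - k)) =
      y ^ p + (x ^ p + (\<Sum>k\<in>{0<..<p}. of_nat (p choose k) * x ^ k * y ^ (p - k)))"
    using p by simp
  finally have "(x + y) ^ p - (x ^ p + y ^ p) =
      (\<Sum>k\<in>{0<..<p}. of_nat (p choose k) * x ^ k * y ^ (p - k))" by (simp add: algebra_simps)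
  also have "of_nat p dvd \<dots>"
  proof (intro dvd_sum dvd_mult2)
    fix k assume "k \<in> {0<..<p}"
    then have "p dvd (p choose k)" using assms by (intro dvd_choose_prime) auto
    then obtain c where "p choose k = p * c" by (rule dvdE)
    then show "of_nat p dvd (of_nat (p choose k) :: 'a)" by (simp only: of_nat_mult dvd_triv_left)
  qed
  finally show ?thesis .
qed

lemma prime_dvd_power_minus_self:
  fixes a :: int
  assumes "prime p"
  shows "int p dvd a ^ p - a"
proof -
  have nat: "int p dvd int n ^ p - int n" for n
  proof (induction n)
    case 0
    then show ?case using assms prime_gt_0_nat[of p] by (simp add: power_0_left)
  next
    case (Suc n)
    have "int p dvd (int n + 1) ^ p - (int n ^ p + 1 ^ p)"
      using prime_dvd_freshmans_defect[OF assms, of "int n" 1] by simp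
    from dvd_add[OF this Suc] show ?case by (simp add: algebra_simps)
  qed
  have "a mod int p = int (nat (a mod int p))" using assms prime_gt_0_nat[of p] by simp
  then have "int p dvd (a mod int p) ^ p - a mod int p" using nat by metis
  then show ?thesis unfolding mod_eq_dvd_iff[symmetric] by (simp add: power_mod)
qed

lemma prime_dvd_frobenius_defect:
  fixes g :: "int poly"
  assumes "prime p"
  shows "of_nat p dvd g ^ p - pcompose g (Polynomial.monom 1 p)"
proof (induction g)
  case 0
  then show ?case using assms prime_gt_0_nat[of p] by (simp add: power_0_left)
next
  case (pCons a g)
  let ?x = "Polynomial.monom 1 1 :: int poly"
  have split: "pCons a g = [:a:] + ?x * g" by (simp add: monom_Suc monom_0)
  have pc: "pcompose (pCons a g) (Polynomial.monom 1 p) = [:a:] + ?x ^ p * pcompose g (Polynomial.monom 1 p)"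
    by (simp add: pcompose_pCons monom_power)
  have "[:a:] ^ p - [:a:] = [:a ^ p - a:]" by (simp add: poly_const_pow)
  moreover have "of_nat p dvd [:a ^ p - a:]"
    using prime_dvd_power_minus_self[OF assms, of a] by (auto simp: of_nat_poly elim!: dvdE)
  ultimately have "of_nat p dvd ([:a:] ^ p - [:a:])" by simp
  moreover have "of_nat p dvd ?x ^ p * (g ^ p - pcompose g (Polynomial.monom 1 p))"
    using pCons.IH by (rule dvd_mult)
  moreover have "of_nat p dvd (pCons a g) ^ p - ([:a:] ^ p + (?x * g) ^ p)"
    unfolding split by (rule prime_dvd_freshmans_defect[OF assms])
  ultimately have "of_nat p dvd ((pCons a g) ^ p - ([:a:] ^ p + (?x * g) ^ p)) +
      (([:a:] ^ p - [:a:]) + ?x ^ p * (g ^ p - pcompose g (Polynomial.monom 1 p)))"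
    by (intro dvd_add)
  then show ?case unfolding pc by (simp add: algebra_simps power_mult_distrib)
qed

text \<open>Compare the highest coefficient of \<open>t\<close> that \<open>p\<close> does not divide.\<close>
lemma prime_dvd_all_coeffs_of_mult:
  fixes \<mu> t :: "int poly"
  assumes p: "prime p" and lc: "\<not> p dvd Polynomial.lead_coeff \<mu>"
    and dvd: "\<And>k. k \<ge> Polynomial.degree \<mu> \<Longrightarrow> p dvd poly.coeff (\<mu> * t) k"
  shows "p dvd poly.coeff t i"
proof (rule ccontr)
  assume "\<not> p dvd poly.coeff t i"
  let ?A = "{i. \<not> p dvd poly.coeff t i}"
  have fin: "finite ?A"
    by (rule finite_subset[of _ "{..Polynomial.degree t}"]) (auto intro!: le_degree)
  define l where "l = Max ?A"
  have "l \<in> ?A" using Max_in[OF fin] \<open>\<not> p dvd poly.coeff t i\<close> unfolding l_def by blast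
  then have l: "\<not> p dvd poly.coeff t l" by simp
  have above: "p dvd poly.coeff t k" if "k > l" for k
    using Max_ge[OF fin, of k] that unfolding l_def by force
  let ?d = "Polynomial.degree \<mu>"
  have "poly.coeff (\<mu> * t) (?d + l) = (\<Sum>k\<le>?d + l. poly.coeff \<mu> k * poly.coeff t (?d + l - k))"
    by (rule coeff_mult)
  also have "\<dots> = poly.coeff \<mu> ?d * poly.coeff t l +
      (\<Sum>k\<in>{..?d + l} - {?d}. poly.coeff \<mu> k * poly.coeff t (?d + l - k))"
    by (subst sum.remove[of _ ?d]) auto
  finally have "poly.coeff \<mu> ?d * poly.coeff t l = poly.coeff (\<mu> * t) (?d + l) -
      (\<Sum>k\<in>{..?d + l} - {?d}. poly.coeff \<mu> k * poly.coeff t (?d + l - k))" by simp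
  moreover have "p dvd (\<Sum>k\<in>{..?d + l} - {?d}. poly.coeff \<mu> k * poly.coeff t (?d + l - k))"
  proof (rule dvd_sum)
    fix k assume "k \<in> {..?d + l} - {?d}"
    then consider "k > ?d" | "?d + l - k > l" by fastforce
    then show "p dvd poly.coeff \<mu> k * poly.coeff t (?d + l - k)"
      by cases (simp_all add: coeff_eq_0 above)
  qed
  ultimately have "p dvd poly.coeff \<mu> ?d * poly.coeff t l" using dvd by simp
  then show False using p lc l by (simp add: prime_dvd_mult_iff)
qed

text \<open>
  Let $\mu$ generate the ideal of integer polynomials that vanish at $w$, and let $\mu g = x^n-1$. If
  $\mu(w^p)\ne0$ then $g(w^p)=0$, so $p$ divides $g(w)^p$ in $\mathbb{Z}[w]$ by the congruence
  $g(x^p)\equiv g(x)^p$. Differentiating gives $n=w\mu'(w)g(w)$, so $p$ divides $n^p$ in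
  $\mathbb{Z}[w]$. This ring is free over $\mathbb{Z}$ with $1$ in a basis, because $\mu$ has leading
  coefficient $\pm1$, so $p$ divides the integer $n^p$, contrary to $p\nmid n$.
\<close>
lemma int_poly_root_conjugate_prime:
  fixes w :: "'k::field_char_0"
  assumes n: "n > 0" and w: "w ^ n = 1" and p: "prime p" "\<not> p dvd n"
    and f: "int_poly_eval f w = 0"
  shows "int_poly_eval f (w ^ p) = 0"
proof -
  let ?c = "Polynomial.monom 1 n - 1 :: int poly"
  have deg_c: "Polynomial.degree ?c = n"
    using n degree_add_eq_left[of "- 1" "Polynomial.monom 1 n :: int poly"] by (simp add: degree_monom_eq)
  have lc_c: "Polynomial.lead_coeff ?c = 1" unfolding deg_c using n by simp
  have "?c \<noteq> 0" using lc_c by fastforce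
  moreover have "int_poly_eval ?c w = 0" using w by simp
  ultimately obtain \<mu> where \<mu>: "\<mu> \<noteq> 0" "int_poly_eval \<mu> w = 0"
    and min: "\<And>f. int_poly_eval f w = 0 \<Longrightarrow> \<mu> dvd f"
    using int_annihilator_generator_exists by blast
  obtain g where g: "?c = \<mu> * g" using min[of ?c] w by (auto elim: dvdE)
  have "int_poly_eval \<mu> (w ^ p) = 0"
  proof (rule ccontr)
    assume nz: "int_poly_eval \<mu> (w ^ p) \<noteq> 0"
    have "int_poly_eval ?c (w ^ p) = 0" using w by (simp add: power_power_commute[of w p n])
    then have "int_poly_eval g (w ^ p) = 0" using nz unfolding g by simp
    then have "int_poly_eval (pcompose g (Polynomial.monom 1 p)) w = 0"
      by (simp add: int_poly_eval_pcompose)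
    moreover obtain r where "g ^ p - pcompose g (Polynomial.monom 1 p) = of_nat p * r"
      using prime_dvd_frobenius_defect[OF p(1), of g] by (auto elim: dvdE)
    then have "int_poly_eval (g ^ p - pcompose g (Polynomial.monom 1 p)) w =
        int_poly_eval ([:int p:] * r) w" by (simp only: of_nat_poly)
    ultimately have gp: "int_poly_eval g w ^ p = of_nat p * int_poly_eval r w" by simp
    have "int_poly_eval (pderiv ?c) w = int_poly_eval (pderiv (\<mu> * g)) w" unfolding g ..
    then have "of_nat n * w ^ (n - 1) = int_poly_eval (pderiv \<mu>) w * int_poly_eval g w"
      using \<mu>(2) by (simp add: pderiv_mult pderiv_diff pderiv_monom pderiv_1 mult.commute)
    then have "w * (int_poly_eval (pderiv \<mu>) w * int_poly_eval g w) = of_nat n * w ^ n"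
      using n by (cases n) (auto simp: mult_ac)
    then have "(w * int_poly_eval (pderiv \<mu>) w * int_poly_eval g w) ^ p = of_nat n ^ p"
      using w by (simp add: mult_ac)
    then have np: "(w * int_poly_eval (pderiv \<mu>) w) ^ p * (of_nat p * int_poly_eval r w) = of_nat n ^ p"
      by (simp only: power_mult_distrib gp)
    define s where "s = (Polynomial.monom 1 1 * pderiv \<mu>) ^ p * r"
    have "int_poly_eval ([:int n ^ p:] - Polynomial.smult (int p) s) w = 0"
      using np by (simp add: s_def mult_ac)
    then obtain t where t: "[:int n ^ p:] - Polynomial.smult (int p) s = \<mu> * t"
      using min by (blast elim: dvdE)
    have deg: "Polynomial.degree \<mu> > 0"
    proof (rule ccontr)
      assume "\<not> Polynomial.degree \<mu> > 0"
      then obtain c where "\<mu> = [:c:]" by (auto elim: degree_eq_zeroE)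
      then show False using \<mu> by simp
    qed
    have "Polynomial.lead_coeff \<mu> * Polynomial.lead_coeff g = 1"
      using lc_c unfolding g by (simp only: lead_coeff_mult)
    then have "Polynomial.lead_coeff \<mu> dvd 1" by (metis dvd_triv_left)
    moreover have "\<not> int p dvd 1" using prime_gt_1_nat[OF p(1)] by simp
    ultimately have lc: "\<not> int p dvd Polynomial.lead_coeff \<mu>" using dvd_trans by blast
    have coeffs: "int p dvd poly.coeff (\<mu> * t) k" if "k \<ge> Polynomial.degree \<mu>" for k
      unfolding t[symmetric] using that deg by (auto simp: coeff_pCons split: nat.split)
    have "prime (int p)" using p(1) by simp
    then have "int p dvd poly.coeff t 0"
      by (rule prime_dvd_all_coeffs_of_mult[OF _ lc coeffs])
    then have "int p dvd poly.coeff ([:int n ^ p:] - Polynomial.smult (int p) s) 0"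
      unfolding t by (simp add: coeff_mult)
    then have "int p dvd (int n ^ p - int p * poly.coeff s 0) + int p * poly.coeff s 0"
      by (intro dvd_add) simp_all
    then have "int p dvd int (n ^ p)" by simp
    then have "p dvd n" unfolding of_nat_dvd_iff using prime_dvd_power[OF p(1)] by simp
    then show False using p(2) by simp
  qed
  moreover obtain q where "f = \<mu> * q" using min[OF f] by (rule dvdE)
  ultimately show ?thesis by simp
qed

text \<open>Pass from $w$ to $w^k$ through the prime factors of $k$, none of which divides $n$.\<close>
lemma int_poly_root_conjugate:
  fixes w :: "'k::field_char_0"
  assumes n: "n > 0" and "w ^ n = 1" and "coprime k n" "k > 0" and "int_poly_eval f w = 0"
  shows "int_poly_eval f (w ^ k) = 0"
  using assms(2-)
proof (induction k arbitrary: w rule: less_induct)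
  case (less k)
  show ?case
  proof (cases "k = 1")
    case False
    obtain p where p: "prime p" "p dvd k" using prime_factor_nat[OF False] by blast
    obtain l where l: "k = p * l" using p(2) by (rule dvdE)
    have "\<not> p dvd n"
    proof
      assume "p dvd n"
      then have "p dvd gcd k n" using p(2) by simp
      then show False using p(1) less.prems(2) by simp
    qed
    then have "int_poly_eval f (w ^ p) = 0"
      by (rule int_poly_root_conjugate_prime[OF n less.prems(1) p(1) _ less.prems(4)])
    moreover have "(w ^ p) ^ n = 1" using less.prems(1) by (simp add: power_power_commute[of w p n])
    moreover have "l < k" "l > 0" using l less.prems(3) prime_gt_1_nat[OF p(1)] by auto
    moreover have "coprime l n" using less.prems(2) l by simp
    ultimately show ?thesis using less.IH[of l "w ^ p"] by (simp add: l power_mult)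
  qed (use less.prems in simp)
qed

section \<open>Fibres of the mask maps over divisors of roots of unity\<close>

lemma sum_mset_powers_fourier:
  fixes y :: "'k::field"
  assumes y: "y ^ d = 1" and R: "\<And>r. r \<in># R \<Longrightarrow> r ^ d = 1" and d: "d > 0"
  shows "(\<Sum>k<d. inverse y ^ k * (\<Sum>r\<in>#R. r ^ k)) = of_nat d * of_nat (count R y)"
  using R
proof (induction R)
  case (add r R)
  have y0: "y \<noteq> 0" using y d by (auto simp: power_0_left)
  have "(inverse y * r) ^ d = 1" using y add.prems[of r] by (simp add: power_mult_distrib power_inverse)
  from sum_powers_root_of_unity[OF this]
  have "(\<Sum>k<d. inverse y ^ k * r ^ k) = (if r = y then of_nat d else 0)"
    using y0 by (auto simp: power_mult_distrib field_simps split: if_splits)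
  then show ?case using add by (simp add: distrib_left sum.distrib algebra_simps)
qed simp

text \<open>Fourier inversion on $C_d$ recovers the multiplicities from the power sums.\<close>
lemma root_of_unity_mset_eqI:
  fixes R R' :: "'k::field_char_0 multiset"
  assumes d: "d > 0" and R: "\<And>r. r \<in># R \<Longrightarrow> r ^ d = 1" and R': "\<And>r. r \<in># R' \<Longrightarrow> r ^ d = 1"
    and eq: "\<And>k. k < d \<Longrightarrow> (\<Sum>r\<in>#R. r ^ k) = (\<Sum>r\<in>#R'. r ^ k)"
  shows "R = R'"
proof (rule multiset_eqI)
  fix y
  show "count R y = count R' y"
  proof (cases "y ^ d = 1")
    case True
    have "of_nat d * of_nat (count R y) = (\<Sum>k<d. inverse y ^ k * (\<Sum>r\<in>#R. r ^ k))"
      by (rule sum_mset_powers_fourier[OF True _ d, symmetric]) (rule R)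
    also have "\<dots> = (\<Sum>k<d. inverse y ^ k * (\<Sum>r\<in>#R'. r ^ k))"
      by (intro sum.cong refl) (simp add: eq)
    also have "\<dots> = of_nat d * of_nat (count R' y)"
      by (rule sum_mset_powers_fourier[OF True _ d]) (rule R')
    finally show ?thesis using d by simp
  next
    case False
    then have "y \<notin># R" "y \<notin># R'" using R R' by blast+
    then show ?thesis by (simp add: not_in_iff)
  qed
qed

definition mask_roots :: "'k::field \<Rightarrow> nat set \<Rightarrow> nat \<Rightarrow> (nat \<Rightarrow> nat) \<Rightarrow> 'k multiset" where
  "mask_roots \<zeta> S m A = image_mset (\<lambda>(i, a). \<zeta> ^ (a + A i)) (mset_set ({..<m} \<times> S))"

lemma mask_form_eq_prod_mask_roots:
  "mask_form \<zeta> S m (\<lambda>i. \<zeta> ^ A i) (\<lambda>i. 1) = (\<Prod>r\<in>#mask_roots \<zeta> S m A. [:- r, 1:])"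
  unfolding mask_form_def prod.cartesian_product mask_roots_def
  by (simp add: prod_unfold_prod_mset image_mset.compositionality o_def case_prod_unfold power_add
      del: prod_mset_prod_list)

lemma proots_prod_linear_mset:
  fixes R :: "'k::field multiset"
  shows "proots (\<Prod>r\<in>#R. [:- r, 1:]) = R"
proof (induction R)
  case (add r R)
  have "(\<Prod>r\<in>#R. [:- r, 1:]) \<noteq> 0" by (auto simp: prod_mset_zero_iff)
  then have "proots ([:- r, 1:] * (\<Prod>r\<in>#R. [:- r, 1:])) = {#r#} + R"
    by (subst proots_mult) (simp_all add: add.IH)
  then show ?case by (simp del: mult_pCons_left)
qed simp

lemma power_sum_mask_roots:
  "(\<Sum>r\<in>#mask_roots \<zeta> S m A. r ^ k) = mask_eigenvalue \<zeta> S k * (\<Sum>i<m. \<zeta> ^ (A i * k))"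
proof -
  have "(\<Sum>r\<in>#mask_roots \<zeta> S m A. r ^ k) = (\<Sum>(i, a)\<in>{..<m} \<times> S. (\<zeta> ^ (a + A i)) ^ k)"
    unfolding mask_roots_def
    by (simp add: sum_unfold_sum_mset image_mset.compositionality o_def case_prod_unfold)
  also have "\<dots> = (\<Sum>i<m. \<Sum>a\<in>S. \<zeta> ^ (a * k) * \<zeta> ^ (A i * k))"
    by (simp add: sum.cartesian_product power_mult[symmetric] power_add[symmetric] distrib_right)
  finally show ?thesis
    by (simp add: mask_eigenvalue_def sum_distrib_left sum_distrib_right)
qed

text \<open>
  The image under $\nu_S$ of a divisor $\sum_i[\zeta^{A_i}:1]$ has the roots $\zeta^a\zeta^{A_i}$ with
  $a\in S$, and their power sums are the products of the transforms of $S$ and of the divisor. So these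
  products agree for two divisors exactly when the images under $\nu_S$ do, and likewise for $T$.
\<close>
lemma factorization_preserves_fibres:
  fixes \<zeta> :: "'k :: {alg_closed_field, field_char_0}"
  assumes d: "d > 0" and \<zeta>: "\<zeta> ^ d = 1"
    and \<phi>: "\<And>p. p \<in> proj_space m \<Longrightarrow> \<phi> (mask_map \<zeta> S m p) = mask_map \<zeta> T m p"
    and S: "\<And>k. mask_eigenvalue \<zeta> S k * (\<Sum>i<m. \<zeta> ^ (A i * k)) =
      mask_eigenvalue \<zeta> S k * (\<Sum>i<m. \<zeta> ^ (B i * k))"
  shows "mask_eigenvalue \<zeta> T k * (\<Sum>i<m. \<zeta> ^ (A i * k)) =
    mask_eigenvalue \<zeta> T k * (\<Sum>i<m. \<zeta> ^ (B i * k))"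
proof -
  \<comment> \<open>The divisor $\<Sum>_i[\<zeta>^{A_i}:1]$.\<close>
  define p where "p A = form_point (\<Prod>i<m. [:- (\<zeta> ^ A i), 1:])" for A
  have p: "p A \<in> proj_space m" for A
    unfolding proj_space_eq_linear_products p_def
    by (rule CollectI, rule exI[of _ "\<lambda>i. \<zeta> ^ A i"], rule exI[of _ "\<lambda>i. 1"]) simp
  have map_p: "mask_map \<zeta> U m (p A) = form_point (\<Prod>r\<in>#mask_roots \<zeta> U m A. [:- r, 1:])" for U A
    unfolding p_def mask_form_eq_prod_mask_roots[symmetric]
    by (rule mask_map_mask_form[of m "\<lambda>i. \<zeta> ^ A i" "\<lambda>i. 1"]) simp
  have \<zeta>a: "(\<zeta> ^ a) ^ d = 1" for a
    by (metis \<zeta> mult.commute power_mult power_one)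
  have roots: "r ^ d = 1" if "r \<in># mask_roots \<zeta> S m A" for r A
    using that by (auto simp: mask_roots_def \<zeta>a dest!: in_image_mset[THEN iffD1])
  have "mask_roots \<zeta> S m A = mask_roots \<zeta> S m B"
    by (rule root_of_unity_mset_eqI[OF d roots roots]) (simp_all add: power_sum_mask_roots S)
  then have "mask_map \<zeta> S m (p A) = mask_map \<zeta> S m (p B)" by (simp add: map_p)
  then have "mask_map \<zeta> T m (p A) = mask_map \<zeta> T m (p B)" using \<phi>[OF p] by metis
  then obtain c where c: "c \<noteq> 0" "(\<Prod>r\<in>#mask_roots \<zeta> T m A. [:- r, 1:]) =
      Polynomial.smult c (\<Prod>r\<in>#mask_roots \<zeta> T m B. [:- r, 1:])"
    unfolding map_p by (blast dest: form_point_eqD)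
  from arg_cong[OF c(2), of proots] have "mask_roots \<zeta> T m A = mask_roots \<zeta> T m B"
    using c(1) by (simp add: proots_prod_linear_mset)
  then show ?thesis unfolding power_sum_mask_roots[symmetric] by simp
qed

section \<open>Small divisors that detect a zero of the Fourier transform\<close>

text \<open>
  Expanding $\prod_{p}(1-x^{q_p})$ gives equally many monomials of either sign, $2^{|P|-1}$ each.
\<close>
lemma exponent_lists_of_product:
  fixes \<zeta> :: "'k::field"
  assumes "finite P" "P \<noteq> {}"
  shows "\<exists>A B. length A = length L * 2 ^ (card P - 1) \<and> length B = length L * 2 ^ (card P - 1) \<and>
    (\<forall>k. (\<Sum>a\<leftarrow>A. \<zeta> ^ (a * k)) - (\<Sum>b\<leftarrow>B. \<zeta> ^ (b * k)) =
      (\<Sum>l\<leftarrow>L. \<zeta> ^ (l * k)) * (\<Prod>p\<in>P. 1 - \<zeta> ^ (q p * k)))"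
  using assms
proof (induction P rule: finite_ne_induct)
  case (singleton p)
  have "(\<Sum>l\<leftarrow>map (\<lambda>l. l + q p) L. \<zeta> ^ (l * k)) = (\<Sum>l\<leftarrow>L. \<zeta> ^ (l * k)) * \<zeta> ^ (q p * k)" for k
    by (simp add: o_def sum_list_mult_const power_add distrib_right)
  then show ?case
    by (intro exI[of _ L] exI[of _ "map (\<lambda>l. l + q p) L"]) (simp add: algebra_simps)
next
  case (insert p P)
  then obtain A B where len: "length A = length L * 2 ^ (card P - 1)" "length B = length L * 2 ^ (card P - 1)"
    and AB: "\<And>k. (\<Sum>a\<leftarrow>A. \<zeta> ^ (a * k)) - (\<Sum>b\<leftarrow>B. \<zeta> ^ (b * k)) =
      (\<Sum>l\<leftarrow>L. \<zeta> ^ (l * k)) * (\<Prod>p\<in>P. 1 - \<zeta> ^ (q p * k))" by blast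
  let ?s = "map (\<lambda>l. l + q p)"
  have shift: "(\<Sum>a\<leftarrow>?s C. \<zeta> ^ (a * k)) = (\<Sum>a\<leftarrow>C. \<zeta> ^ (a * k)) * \<zeta> ^ (q p * k)" for C k
    by (simp add: o_def sum_list_mult_const power_add distrib_right)
  have diff: "(\<Sum>a\<leftarrow>A @ ?s B. \<zeta> ^ (a * k)) - (\<Sum>b\<leftarrow>B @ ?s A. \<zeta> ^ (b * k)) =
      (\<Sum>l\<leftarrow>L. \<zeta> ^ (l * k)) * (\<Prod>p\<in>insert p P. 1 - \<zeta> ^ (q p * k))" for k
  proof -
    have "(\<Sum>a\<leftarrow>A @ ?s B. \<zeta> ^ (a * k)) - (\<Sum>b\<leftarrow>B @ ?s A. \<zeta> ^ (b * k)) =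
        ((\<Sum>a\<leftarrow>A. \<zeta> ^ (a * k)) - (\<Sum>b\<leftarrow>B. \<zeta> ^ (b * k))) * (1 - \<zeta> ^ (q p * k))"
      unfolding map_append sum_list_append shift by (simp add: algebra_simps)
    then show ?thesis unfolding AB prod.insert[OF insert.hyps(1,3)] by (simp add: mult_ac)
  qed
  have "length L * 2 ^ (card (insert p P) - 1) = length L * 2 ^ (card P - 1) * 2"
    using insert.hyps by (cases "card P") auto
  then have "length (A @ ?s B) = length L * 2 ^ (card (insert p P) - 1)"
      "length (B @ ?s A) = length L * 2 ^ (card (insert p P) - 1)"
    unfolding length_append length_map len by linarith+
  then show ?case using diff by blast
qed

text \<open>
  With $q$ the least prime factor of $d$ and $r$ the number of prime factors of $n$, this comes down
  to $q\,2^{r-1}\le n$: one prime factor of $n$ is at least $q$ and the others are at least $2$.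
\<close>
lemma number_of_exponents_bound:
  assumes d: "d \<ge> 2" and d_eq: "d = e * n" and n: "n > 1"
  shows "e * 2 ^ (card (prime_factors n) - 1) \<le> largest_proper_divisor d"
proof -
  define q where "q = Min (prime_factors d)"
  have "prime_factors d \<noteq> {}" using d prime_factor_nat[of d] by (auto simp: prime_factors_dvd)
  then have "q \<in> prime_factors d" unfolding q_def by (intro Min_in) auto
  then have q0: "q > 0" by (auto intro: prime_gt_0_nat)
  obtain p0 where p0: "p0 \<in> prime_factors n"
    using n prime_factor_nat[of n] by (auto simp: prime_factors_dvd)
  have "p0 \<in> prime_factors d" using p0 d by (cases "e = 0") (auto simp: d_eq in_prime_factors_iff)
  then have q_le: "q \<le> p0" unfolding q_def by (intro Min_le) auto
  have "q * 2 ^ (card (prime_factors n) - 1) = q * (\<Prod>p\<in>prime_factors n - {p0}. 2)"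
    using p0 by (simp add: card_Diff_singleton)
  also have "\<dots> \<le> p0 * (\<Prod>p\<in>prime_factors n - {p0}. p)"
    using q_le by (intro mult_mono prod_mono) (auto intro: prime_ge_2_nat)
  also have "\<dots> = (\<Prod>p\<in>prime_factors n. p)"
    using p0 by (simp add: prod.remove)
  also have "\<dots> \<le> (\<Prod>p\<in>prime_factors n. p ^ multiplicity p n)"
  proof (rule prod_mono)
    fix p assume p: "p \<in> prime_factors n"
    then have "multiplicity p n \<ge> 1" "p \<ge> 1"
      by (auto simp: prime_factors_multiplicity Suc_le_eq intro: prime_gt_0_nat)
    then have "p ^ 1 \<le> p ^ multiplicity p n" by (intro power_increasing)
    then show "0 \<le> p \<and> p \<le> p ^ multiplicity p n" by simp
  qed
  also have "\<dots> = n" using n by (intro prime_factorization_nat[symmetric]) simp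
  finally have "e * (q * 2 ^ (card (prime_factors n) - 1)) \<le> d"
    unfolding d_eq by (rule mult_le_mono2)
  then show ?thesis unfolding largest_proper_divisor_def q_def[symmetric]
    using q0 by (simp add: less_eq_div_iff_mult_less_eq mult_ac)
qed

lemma primitive_root_power_eq_1_iff:
  assumes "primitive_root_of_unity d \<zeta>" "d > 0"
  shows "\<zeta> ^ x = 1 \<longleftrightarrow> d dvd x"
proof -
  have \<zeta>: "\<zeta> ^ d = 1" "\<And>k. 0 < k \<Longrightarrow> k < d \<Longrightarrow> \<zeta> ^ k \<noteq> 1"
    using assms(1) unfolding primitive_root_of_unity_def by auto
  have "\<zeta> ^ x = \<zeta> ^ (d * (x div d) + x mod d)" by simp
  also have "\<dots> = \<zeta> ^ (x mod d)" unfolding power_add power_mult \<zeta>(1) by simp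
  finally have "\<zeta> ^ x = \<zeta> ^ (x mod d)" .
  moreover have "x mod d < d" using assms(2) by simp
  ultimately show ?thesis using \<zeta>(2)[of "x mod d"] by (cases "x mod d = 0") (auto simp: dvd_eq_mod_eq_0)
qed

text \<open>
  Both eigenvalues are values of the integer polynomial $\sum_{a\in S}x^a$, at $\zeta^{ej}$ and at
  $\zeta^{ek}$, and the second point is a power of the first with exponent prime to $n$.
\<close>
lemma mask_eigenvalue_zero_conjugate:
  fixes \<zeta> :: "'k::field_char_0"
  assumes \<zeta>: "\<zeta> ^ (e * n) = 1" and n: "n > 1"
    and cop: "coprime j n" "coprime k n" and zero: "mask_eigenvalue \<zeta> S (e * j) = 0"
  shows "mask_eigenvalue \<zeta> S (e * k) = 0"
proof -
  define f :: "int poly" where "f = (\<Sum>a\<in>S. Polynomial.monom 1 a)"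
  have f: "int_poly_eval f (\<zeta> ^ l) = mask_eigenvalue \<zeta> S l" for l
    by (simp add: f_def mask_eigenvalue_def mult.commute flip: power_mult)
  obtain x where x: "[j * x = 1] (mod n)" using cong_solve_coprime_nat[OF cop(1)] by auto
  have x0: "x > 0" using x n by (auto intro: Nat.gr0I simp: cong_def)
  have k0: "k > 0" using cop(2) n by (auto intro: Nat.gr0I)
  have "coprime (j * x) n" using cong_imp_coprime[OF cong_sym[OF x]] by simp
  then have cop': "coprime (x * k) n" using cop(2) by simp
  have root: "(\<zeta> ^ (e * j)) ^ n = 1"
    by (metis \<zeta> mult.commute mult.left_commute power_mult power_one)
  have "int_poly_eval f ((\<zeta> ^ (e * j)) ^ (x * k)) = 0"
    by (rule int_poly_root_conjugate[OF _ root cop']) (use n x0 k0 zero in \<open>simp_all add: f\<close>)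
  moreover have "(\<zeta> ^ (e * j)) ^ (x * k) = \<zeta> ^ (e * k)"
  proof -
    have mod: "\<zeta> ^ y = \<zeta> ^ (y mod (e * n))" for y
    proof -
      have "\<zeta> ^ y = \<zeta> ^ (e * n * (y div (e * n)) + y mod (e * n))" by simp
      then show ?thesis unfolding power_add power_mult[of _ "e * n"] \<zeta> by simp
    qed
    have "[j * x * k = 1 * k] (mod n)" using x by (rule cong_scalar_right)
    then have "(j * x * k) mod n = k mod n" by (simp add: cong_def)
    then have "(e * (j * x * k)) mod (e * n) = (e * k) mod (e * n)"
      by (simp only: mult_mod_right[symmetric])
    then have "\<zeta> ^ (e * (j * x * k)) = \<zeta> ^ (e * k)" using mod by metis
    then show ?thesis by (simp add: mult_ac flip: power_mult)
  qed
  ultimately show ?thesis by (simp only: f)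
qed

text \<open>
  Let $\lambda_j(S)=0$ and $e=\gcd(j,d)$. All $\lambda_k(S)$ with $\gcd(k,d)=e$ vanish, by conjugacy. Two
  divisors of degree $m$ whose transforms differ exactly at these $k$ have the same image under
  $\nu_S$, hence under $\nu_T$, and comparing transforms at $j$ gives $\lambda_j(T)=0$. The bound $b(d)$
  is what makes room for such a pair of divisors.
\<close>
lemma factorization_imp_mask_zeros_subset:
  fixes \<zeta> :: "'k :: {alg_closed_field, field_char_0}"
  assumes d: "d \<ge> 2" and prim: "primitive_root_of_unity d \<zeta>" and fin: "finite S" and ne: "S \<noteq> {}"
    and m: "m \<ge> largest_proper_divisor d"
    and \<phi>: "\<And>p. p \<in> proj_space m \<Longrightarrow> \<phi> (mask_map \<zeta> S m p) = mask_map \<zeta> T m p"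
  shows "mask_zeros d \<zeta> S \<subseteq> mask_zeros d \<zeta> T"
proof
  fix j assume "j \<in> mask_zeros d \<zeta> S"
  then have j: "j < d" "mask_eigenvalue \<zeta> S j = 0" by (auto simp: mask_zeros_def)
  have d0: "d > 0" using d by simp
  have \<zeta>: "\<zeta> ^ d = 1" using prim by (simp add: primitive_root_of_unity_def)
  note one_iff = primitive_root_power_eq_1_iff[OF prim d0]
  have "j \<noteq> 0"
  proof
    assume "j = 0"
    then have "of_nat (card S) = (0 :: 'k)" using j(2) by (simp add: mask_eigenvalue_def)
    then show False using fin ne by simp
  qed
  define e where "e = gcd j d"
  define n where "n = d div e"
  define j' where "j' = j div e"
  have e0: "e > 0" using d0 by (simp add: e_def)
  have d_eq: "d = e * n" and j_eq: "j = e * j'" by (auto simp: n_def j'_def e_def)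
  have "e \<le> j" using \<open>j \<noteq> 0\<close> by (simp add: e_def)
  then have n1: "n > 1" using j(1) d_eq by (cases "n = 0 \<or> n = 1") auto
  have cop: "coprime j' n"
    unfolding n_def j'_def e_def using d0 by (intro div_gcd_coprime) simp
  let ?P = "prime_factors n"
  have P: "?P \<noteq> {}" using n1 prime_factor_nat[of n] by (auto simp: prime_factors_dvd)
  \<comment> \<open>This progression has nonzero transform only at the multiples of $e$; the factors $1-x^{n/p}$
    then remove the $k$ for which $k/e$ is not prime to $n$.\<close>
  let ?L = "map (\<lambda>i. n * i) [0..<e]"
  define E where "E k = (\<Sum>l\<leftarrow>?L. \<zeta> ^ (l * k)) * (\<Prod>p\<in>?P. 1 - \<zeta> ^ (n div p * k))" for k
  obtain A B where len: "length A = e * 2 ^ (card ?P - 1)" "length B = e * 2 ^ (card ?P - 1)"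
    and AB: "\<And>k. (\<Sum>a\<leftarrow>A. \<zeta> ^ (a * k)) - (\<Sum>b\<leftarrow>B. \<zeta> ^ (b * k)) = E k"
    using exponent_lists_of_product[OF _ P, of ?L \<zeta> "\<lambda>p. n div p"] unfolding E_def by auto
  have len_m: "length A \<le> m" "length B = length A"
    using number_of_exponents_bound[OF d d_eq n1] m len by simp_all
  \<comment> \<open>Adding the root $1$ to both divisors brings their degree up to $m$ without changing the
    difference.\<close>
  define pad where "pad C = C @ replicate (m - length A) 0" for C :: "nat list"
  have pad: "(\<Sum>i<m. \<zeta> ^ (pad C ! i * k)) = (\<Sum>c\<leftarrow>C. \<zeta> ^ (c * k)) + of_nat (m - length A)"
    if "length C = length A" for C k
  proof -
    have "length (pad C) = m" using that len_m by (simp add: pad_def)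
    then have "(\<Sum>i<m. \<zeta> ^ (pad C ! i * k)) = (\<Sum>c\<leftarrow>pad C. \<zeta> ^ (c * k))"
      by (simp add: sum_list_sum_nth atLeast0LessThan)
    then show ?thesis by (simp add: pad_def sum_list_replicate)
  qed
  have diff: "(\<Sum>i<m. \<zeta> ^ (pad A ! i * k)) - (\<Sum>i<m. \<zeta> ^ (pad B ! i * k)) = E k" for k
    using AB[of k] by (simp add: pad len_m)
  have geo: "(\<Sum>l\<leftarrow>?L. \<zeta> ^ (l * k)) = (if e dvd k then of_nat e else 0)" for k
  proof -
    have "(\<Sum>l\<leftarrow>?L. \<zeta> ^ (l * k)) = (\<Sum>i<e. (\<zeta> ^ (n * k)) ^ i)"
      by (simp add: o_def sum_list_distinct_conv_sum_set atLeast0LessThan mult_ac flip: power_mult)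
    moreover have "(\<zeta> ^ (n * k)) ^ e = 1"
      unfolding power_mult[symmetric] one_iff d_eq by simp
    moreover have "\<zeta> ^ (n * k) = 1 \<longleftrightarrow> e dvd k"
      unfolding one_iff d_eq using n1 by (simp add: mult.commute)
    ultimately show ?thesis by (simp only: sum_powers_root_of_unity)
  qed
  have E_eq: "E k = (if e dvd k then of_nat e else 0) * (\<Prod>p\<in>?P. 1 - \<zeta> ^ (n div p * k))" for k
    unfolding E_def geo ..
  have "E k * mask_eigenvalue \<zeta> S k = 0" for k
  proof (cases "e dvd k \<and> coprime (k div e) n")
    case True
    have "\<zeta> ^ (e * n) = 1" using \<zeta> by (simp only: d_eq)
    moreover have "mask_eigenvalue \<zeta> S (e * j') = 0" using j(2) by (simp only: j_eq)
    ultimately have "mask_eigenvalue \<zeta> S (e * (k div e)) = 0"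
      using True mask_eigenvalue_zero_conjugate[OF _ n1 cop] by blast
    then show ?thesis using True by simp
  next
    case False
    show ?thesis
    proof (cases "e dvd k")
      case True
      define k' where "k' = k div e"
      have k: "k = e * k'" using True by (simp add: k'_def)
      have "\<not> coprime k' n" using False True by (simp add: k'_def)
      then have "gcd k' n \<noteq> 1" by (simp add: coprime_iff_gcd_eq_1)
      then obtain p where p: "prime p" "p dvd gcd k' n" using prime_factor_nat[of "gcd k' n"] by blast
      then have "p dvd k'" "p dvd n" by auto
      then obtain r s where r: "k' = p * r" and s: "n = p * s" by (auto elim!: dvdE)
      have "n div p * k = e * n * r" using p(1) prime_gt_0_nat[of p] unfolding k r s by simp
      then have "\<zeta> ^ (n div p * k) = 1" unfolding one_iff d_eq by simp
      moreover have "p \<in> ?P" using p(1) \<open>p dvd n\<close> n1 by (simp add: prime_factors_dvd)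
      ultimately have "(\<Prod>p\<in>?P. 1 - \<zeta> ^ (n div p * k)) = 0" by (intro prod_zero) auto
      then show ?thesis by (simp add: E_eq)
    qed (simp add: E_eq)
  qed
  then have "mask_eigenvalue \<zeta> S k * (\<Sum>i<m. \<zeta> ^ (pad A ! i * k)) =
      mask_eigenvalue \<zeta> S k * (\<Sum>i<m. \<zeta> ^ (pad B ! i * k))" for k
    unfolding diff[symmetric] by (simp add: algebra_simps)
  from factorization_preserves_fibres[OF d0 \<zeta> \<phi> this, of j]
  have "mask_eigenvalue \<zeta> T j * E j = 0" unfolding diff[symmetric] by (simp add: algebra_simps)
  moreover have "E j \<noteq> 0"
  proof -
    have "1 - \<zeta> ^ (n div p * j) \<noteq> 0" if p: "p \<in> ?P" for p
    proof
      have "prime p" "p dvd n" using p by auto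
      then obtain s where s: "n = p * s" by (auto elim: dvdE)
      assume "1 - \<zeta> ^ (n div p * j) = 0"
      then have "e * n dvd n div p * (e * j')" using one_iff unfolding d_eq j_eq by simp
      then have "s * p dvd s * j'" using e0 \<open>prime p\<close> prime_gt_0_nat[of p] unfolding s
        by (simp add: mult_ac)
      then have "p dvd j'" using n1 s by auto
      then have "p dvd gcd j' n" using \<open>p dvd n\<close> by simp
      then show False using cop \<open>prime p\<close> by simp
    qed
    then show ?thesis using e0 by (simp add: E_eq j_eq)
  qed
  ultimately show "j \<in> mask_zeros d \<zeta> T" using j(1) by (simp add: mask_zeros_def)
qed

section \<open>The classification of mask varieties over their normalization\<close>

theorem theorem3p6:
  fixes \<zeta> :: "'k :: {alg_closed_field, field_char_0}"
    and d :: nat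
    and S T :: "nat set"
  assumes "d \<ge> 2"
    and "primitive_root_of_unity d \<zeta>"
    and "S \<subseteq> {..<d}" and "S \<noteq> {}" and "aperiodic_mask d S"
    and "T \<subseteq> {..<d}" and "T \<noteq> {}" and "aperiodic_mask d T"
  shows "(mask_zeros d \<zeta> S = mask_zeros d \<zeta> T \<longrightarrow>
           (\<forall>m\<ge>1. \<exists>!\<phi>.
              variety_isomorphism (m * card S) (mask_variety \<zeta> S m)
                (m * card T) (mask_variety \<zeta> T m) \<phi> \<and>
              (\<forall>p\<in>proj_space m. \<phi> (mask_map \<zeta> S m p) = mask_map \<zeta> T m p))) \<and>
         (\<forall>m\<ge>largest_proper_divisor d.
           (\<exists>\<phi>. variety_isomorphism (m * card S) (mask_variety \<zeta> S m)
                (m * card T) (mask_variety \<zeta> T m) \<phi> \<and>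
              (\<forall>p\<in>proj_space m. \<phi> (mask_map \<zeta> S m p) = mask_map \<zeta> T m p)) \<longrightarrow>
           mask_zeros d \<zeta> S = mask_zeros d \<zeta> T)"
proof -
  have d: "d > 0" and \<zeta>: "\<zeta> ^ d = 1"
    using assms(1,2) by (simp_all add: primitive_root_of_unity_def)
  have fin: "finite S" "finite T" using assms(3,6) finite_subset by blast+
  have converse: "mask_zeros d \<zeta> S = mask_zeros d \<zeta> T"
    if m: "largest_proper_divisor d \<le> m"
      and iso: "variety_isomorphism (m * card S) (mask_variety \<zeta> S m) (m * card T) (mask_variety \<zeta> T m) \<phi>"
      and \<phi>: "\<forall>p\<in>proj_space m. \<phi> (mask_map \<zeta> S m p) = mask_map \<zeta> T m p" for m \<phi>
  proof
    show "mask_zeros d \<zeta> S \<subseteq> mask_zeros d \<zeta> T"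
      by (rule factorization_imp_mask_zeros_subset[where \<phi> = \<phi>, OF assms(1,2) fin(1) assms(4) m]) (use \<phi> in blast)
    obtain \<psi> where \<psi>: "\<forall>q\<in>mask_variety \<zeta> S m. \<psi> (\<phi> q) = q"
      using iso unfolding variety_isomorphism_def by (elim exE conjE)
    have "\<psi> (mask_map \<zeta> T m p) = mask_map \<zeta> S m p" if "p \<in> proj_space m" for p
    proof -
      have "mask_map \<zeta> S m p \<in> mask_variety \<zeta> S m" using that by (simp add: mask_variety_def)
      then have "\<psi> (\<phi> (mask_map \<zeta> S m p)) = mask_map \<zeta> S m p" using \<psi> by blast
      then show ?thesis using \<phi> that by simp
    qed
    then show "mask_zeros d \<zeta> T \<subseteq> mask_zeros d \<zeta> S"
      by (rule factorization_imp_mask_zeros_subset[OF assms(1,2) fin(2) assms(7) m])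
  qed
  show ?thesis
    by (intro conjI impI allI mask_transfer_isomorphism[OF d \<zeta> fin assms(4,7)])
      (assumption, elim exE conjE, rule converse)
qed

end
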